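(* Let $(X,M,* )$ be a uniformly locally finite fuzzy metric space (with $*$ having no zero divisors). The following are equivalent: (i) $X$ has property A. (ii) For every $\varepsilon>0$, $r\in(0,1)$, and $t>0$, there exists a map $\eta:X\to\ell^1(X)$, $x\mapsto\eta_x$, such that $\|\eta_x\|_1=1$ for all $x\in X$; $\|\eta_x-\eta_y\|_1<\varepsilon$ if $M(x,y,t)>1-r$; and there exist $R\in(0,1)$ and $T>0$ such that $\mathrm{supp}(\eta_x)\subseteq B(x,R,T)$ for all $x\in X$. (iii) For every $\varepsilon>0$, $r\in(0,1)$, and $t>0$, there exists a map $\eta:X\to\ell^2(X)$, $x\mapsto\eta_x$, such that $\|\eta_x\|_2=1$ for all $x\in X$; $\|\eta_x-\eta_y\|_2<\varepsilon$ if $M(x,y,t)>1-r$; and there exist $R\in(0,1)$ and $T>0$ such that $\mathrm{supp}(\eta_x)\subseteq B(x,R,T)$ for all $x\in X$. (iv) For every $\varepsilon>0$, $r\in(0,1)$, and $t>0$, there exist a Hilbert space $H$ and a map $\eta:X\to H$, $x\mapsto\eta_x$, such that $\|\eta_x\|=1$ for all $x\in X$; $\|\eta_x-\eta_y\|<\varepsilon$ if $M(x,y,t)>1-r$; and there exist $R\in(0,1)$ and $T>0$ such that $\langle\eta_x,\eta_y\rangle=0$ whenever $M(x,y,T)<1-R$. (v) For every $\varepsilon>0$, $r\in(0,1)$, and $t>0$, there exist $R\in(0,1)$, $T>0$, and a positive definite kernel $k:X\times X\to\mathbb{R}$ such that $|1-k(x,y)|<\varepsilon$ if $M(x,y,t)>1-r$;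 and $k(x,y)=0$ whenever $M(x,y,T)<1-R$. (vi) For every $\varepsilon>0$, $r\in(0,1)$, and $t>0$, there exist $R\in(0,1)$, $T>0$, and a positive definite kernel $k:X\times X\to\mathbb{C}$ such that $|1-k(x,y)|<\varepsilon$ if $M(x,y,t)>1-r$; $k(x,y)=0$ whenever $M(x,y,T)<1-R$; and convolution with $k$, given by $(S_k\xi)_x=\sum_{y\in X}k(x,y)\xi_y$, defines a bounded linear operator $S_k$ on $\ell^2(X)$ belonging to the uniform Roe algebra $C^*_u(X)$.
   Context: A continuous $t$-norm is a continuous, associative, commutative binary operation $*$ on $[0,1]$ with $a*1=a$ for all $a$, and $a*b\leq c*d$ whenever $a\leq c$ and $b\leq d$. Standing assumption: $*$ has no zero divisors, i.e. $a*b\neq 0$ whenever $a\neq 0$ and $b\neq 0$. A fuzzy metric space (George–Veeramani) is a triple $(X,M,* )$ with $X$ a set, $*$ a continuous $t$-norm, and $M:X\times X\times(0,\infty)\to[0,1]$ such that for all $x,y,z\in X$ and $s,t>0$: (1) $M(x,y,t)>0$; (2) $M(x,y,t)=1$ if and only if $x=y$; (3) $M(x,y,t)=M(y,x,t)$; (4) $M(x,y,t)*M(y,z,s)\leq M(x,z,t+s)$; (5) $M(x,y,\cdot)$ is continuous on $(0,\infty)$. For $x\in X$, $r\in(0,1)$, $t>0$, the ball is $B(x,r,t)=\{y\in X:M(x,y,t)>1-r\}$. The space is uniformly locally finite if for every $r\in(0,1)$ and $t>0$ there is $N_{r,t}>0$ with $|B(x,r,t)|<N_{r,t}$ for all $x\in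 X$. A uniformly locally finite fuzzy metric space $(X,M,* )$ has property A if for every $\varepsilon>0$, $t>0$, $r\in(0,1)$ there exist $t'>0$, $r'\in(0,1)$ and a family $\{A_x\}_{x\in X}$ of non-empty finite subsets of $X\times\mathbb{N}$ such that $A_x\subset B(x,r',t')\times\mathbb{N}$ for each $x$, and $|A_x\Delta A_y|<\varepsilon|A_x\cap A_y|$ whenever $M(x,y,t)>1-r$. Here $\Delta$ is symmetric difference. A map $k:X\times X\to\mathbb{C}$ (resp. $\mathbb{R}$) is a positive definite kernel if for all finite sequences $x_1,\ldots,x_n$ in $X$ and $\lambda_1,\ldots,\lambda_n\in\mathbb{C}$ (resp. $\mathbb{R}$), $\sum_{i,j=1}^n\lambda_i\overline{\lambda_j}k(x_i,x_j)\geq 0$. $B(\ell^2(X))$ is the set of bounded linear operators on $\ell^2(X)$, and $\delta_x\in\ell^2(X)$ is the standard basis vector at $x$. An operator $S\in B(\ell^2(X))$ has finite propagation if there exist $t>0$ and $r\in(0,1)$ such that $\langle S\delta_y,\delta_x\rangle=0$ whenever $M(x,y,t)<1-r$. The uniform Roe algebra $C^*_u(X)$ is the operator norm closure in $B(\ell^2(X))$ of the set of all bounded operators on $\ell^2(X)$ with finite propagation. *)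

theory Defs
  imports "HOL-Analysis.Analysis"
begin

section \<open>Fuzzy metric spaces\<close>

text \<open>Operations and fuzzy metrics are total functions in HOL; only their values on the
  unit square, respectively on \<open>X \<times> X \<times> (0,\<infinity>)\<close>, are constrained or used.\<close>

locale continuous_t_norm =
  fixes T :: "real \<Rightarrow> real \<Rightarrow> real"
  assumes T_closed: "a \<in> {0..1} \<Longrightarrow> b \<in> {0..1} \<Longrightarrow> T a b \<in> {0..1}"
    and T_continuous: "continuous_on ({0..1} \<times> {0..1}) (\<lambda>(a, b). T a b)"
    and T_assoc: "a \<in> {0..1} \<Longrightarrow> b \<in> {0..1} \<Longrightarrow> c \<in> {0..1} \<Longrightarrow> T (T a b) c = T a (T b c)"
    and T_commute: "a \<in> {0..1} \<Longrightarrow> b \<in> {0..1} \<Longrightarrow> T a b = T b a"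
    and T_right_unit: "a \<in> {0..1} \<Longrightarrow> T a 1 = a"
    and T_mono: "a \<in> {0..1} \<Longrightarrow> b \<in> {0..1} \<Longrightarrow> c \<in> {0..1} \<Longrightarrow> d \<in> {0..1} \<Longrightarrow>
                 a \<le> c \<Longrightarrow> b \<le> d \<Longrightarrow> T a b \<le> T c d"

definition no_zero_divisors :: "(real \<Rightarrow> real \<Rightarrow> real) \<Rightarrow> bool" where
  "no_zero_divisors T \<longleftrightarrow> (\<forall>a\<in>{0..1}. \<forall>b\<in>{0..1}. a \<noteq> 0 \<longrightarrow> b \<noteq> 0 \<longrightarrow> T a b \<noteq> 0)"

locale fuzzy_metric_space = continuous_t_norm T
  for X :: "'a set" and M :: "'a \<Rightarrow> 'a \<Rightarrow> real \<Rightarrow> real" and T :: "real \<Rightarrow> real \<Rightarrow> real" +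
  assumes M_range: "x \<in> X \<Longrightarrow> y \<in> X \<Longrightarrow> t > 0 \<Longrightarrow> M x y t \<in> {0..1}"
    and M_pos: "x \<in> X \<Longrightarrow> y \<in> X \<Longrightarrow> t > 0 \<Longrightarrow> M x y t > 0"
    and M_eq_1_iff: "x \<in> X \<Longrightarrow> y \<in> X \<Longrightarrow> t > 0 \<Longrightarrow> M x y t = 1 \<longleftrightarrow> x = y"
    and M_sym: "x \<in> X \<Longrightarrow> y \<in> X \<Longrightarrow> t > 0 \<Longrightarrow> M x y t = M y x t"
    and M_triangle: "x \<in> X \<Longrightarrow> y \<in> X \<Longrightarrow> z \<in> X \<Longrightarrow> s > 0 \<Longrightarrow> t > 0 \<Longrightarrow>
                     T (M x y t) (M y z s) \<le> M x z (t + s)"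
    and M_continuous: "x \<in> X \<Longrightarrow> y \<in> X \<Longrightarrow> continuous_on {0<..} (M x y)"

definition fball :: "'a set \<Rightarrow> ('a \<Rightarrow> 'a \<Rightarrow> real \<Rightarrow> real) \<Rightarrow> 'a \<Rightarrow> real \<Rightarrow> real \<Rightarrow> 'a set" where
  "fball X M x r t = {y \<in> X. M x y t > 1 - r}"

definition uniformly_locally_finite ::
    "'a set \<Rightarrow> ('a \<Rightarrow> 'a \<Rightarrow> real \<Rightarrow> real) \<Rightarrow> bool" where
  "uniformly_locally_finite X M \<longleftrightarrow>
     (\<forall>r\<in>{0<..<1}. \<forall>t>0. \<exists>N::nat. N > 0 \<and>
        (\<forall>x\<in>X. finite (fball X M x r t) \<and> card (fball X M x r t) < N))"

definition property_A :: "'a set \<Rightarrow> ('a \<Rightarrow> 'a \<Rightarrow> real \<Rightarrow> real) \<Rightarrow> bool" where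
  "property_A X M \<longleftrightarrow>
     (\<forall>\<epsilon>>0. \<forall>t>0. \<forall>r\<in>{0<..<1}.
        \<exists>t'>0. \<exists>r'\<in>{0<..<1}. \<exists>A :: 'a \<Rightarrow> ('a \<times> nat) set.
          (\<forall>x\<in>X. finite (A x) \<and> A x \<noteq> {} \<and> A x \<subseteq> fball X M x r' t' \<times> UNIV) \<and>
          (\<forall>x\<in>X. \<forall>y\<in>X. M x y t > 1 - r \<longrightarrow>
             real (card (sym_diff (A x) (A y))) < \<epsilon> * real (card (A x \<inter> A y))))"


section \<open>The spaces \<open>\<ell>\<^sup>p(X)\<close>\<close>

text \<open>Elements of \<open>\<ell>\<^sup>p(X)\<close>, for integer \<open>p \<ge> 1\<close>, are represented by complex functions on the
  ambient type that vanish off \<open>X\<close>, so that equality of functions is equality in \<open>\<ell>\<^sup>p(X)\<close>.\<close>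

definition lp_space :: "nat \<Rightarrow> 'a set \<Rightarrow> ('a \<Rightarrow> complex) set" where
  "lp_space p X = {f. (\<forall>x. x \<notin> X \<longrightarrow> f x = 0) \<and> (\<lambda>x. cmod (f x) ^ p) summable_on X}"

definition lp_norm :: "nat \<Rightarrow> 'a set \<Rightarrow> ('a \<Rightarrow> complex) \<Rightarrow> real" where
  "lp_norm p X f = root p (\<Sum>\<^sub>\<infinity>x\<in>X. cmod (f x) ^ p)"

definition l2_inner :: "'a set \<Rightarrow> ('a \<Rightarrow> complex) \<Rightarrow> ('a \<Rightarrow> complex) \<Rightarrow> complex" where
  "l2_inner X f g = (\<Sum>\<^sub>\<infinity>x\<in>X. f x * cnj (g x))"

definition delta :: "'a \<Rightarrow> 'a \<Rightarrow> complex" where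
  "delta x = (\<lambda>y. if y = x then 1 else 0)"


section \<open>Complex Hilbert spaces on a carrier set\<close>

text \<open>HOL-Analysis has only real inner product spaces, and as type classes, over which one cannot
  quantify existentially. So \<open>H\<close> is a set, with explicit operations.\<close>

definition hilbert_norm :: "('h \<Rightarrow> 'h \<Rightarrow> complex) \<Rightarrow> 'h \<Rightarrow> real" where
  "hilbert_norm ip v = sqrt (Re (ip v v))"

definition hilbert_dist ::
    "('h \<Rightarrow> 'h \<Rightarrow> 'h) \<Rightarrow> (complex \<Rightarrow> 'h \<Rightarrow> 'h) \<Rightarrow> ('h \<Rightarrow> 'h \<Rightarrow> complex) \<Rightarrow> 'h \<Rightarrow> 'h \<Rightarrow> real" where
  "hilbert_dist add smul ip v w = hilbert_norm ip (add v (smul (- 1) w))"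

locale complex_hilbert_space =
  fixes H :: "'h set" and zero :: 'h and add :: "'h \<Rightarrow> 'h \<Rightarrow> 'h"
    and smul :: "complex \<Rightarrow> 'h \<Rightarrow> 'h" and ip :: "'h \<Rightarrow> 'h \<Rightarrow> complex"
  assumes zero_closed: "zero \<in> H"
    and add_closed: "u \<in> H \<Longrightarrow> v \<in> H \<Longrightarrow> add u v \<in> H"
    and scale_closed: "v \<in> H \<Longrightarrow> smul a v \<in> H"
    and add_assoc: "u \<in> H \<Longrightarrow> v \<in> H \<Longrightarrow> w \<in> H \<Longrightarrow> add (add u v) w = add u (add v w)"
    and add_commute: "u \<in> H \<Longrightarrow> v \<in> H \<Longrightarrow> add u v = add v u"
    and add_zero: "v \<in> H \<Longrightarrow> add v zero = v"
    and add_inverse: "v \<in> H \<Longrightarrow> \<exists>w\<in>H. add v w = zero"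
    and scale_add: "u \<in> H \<Longrightarrow> v \<in> H \<Longrightarrow> smul a (add u v) = add (smul a u) (smul a v)"
    and add_scale: "v \<in> H \<Longrightarrow> smul (a + b) v = add (smul a v) (smul b v)"
    and scale_scale: "v \<in> H \<Longrightarrow> smul a (smul b v) = smul (a * b) v"
    and scale_one: "v \<in> H \<Longrightarrow> smul 1 v = v"
    and ip_add: "u \<in> H \<Longrightarrow> v \<in> H \<Longrightarrow> w \<in> H \<Longrightarrow> ip (add u v) w = ip u w + ip v w"
    and ip_scale: "v \<in> H \<Longrightarrow> w \<in> H \<Longrightarrow> ip (smul a v) w = a * ip v w"
    and ip_cnj: "v \<in> H \<Longrightarrow> w \<in> H \<Longrightarrow> ip w v = cnj (ip v w)"
    and ip_nonneg: "v \<in> H \<Longrightarrow> ip v v \<in> \<real>\<^sub>\<ge>\<^sub>0"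
    and ip_definite: "v \<in> H \<Longrightarrow> ip v v = 0 \<Longrightarrow> v = zero"
    and complete: "Metric_space.mcomplete H (hilbert_dist add smul ip)"


section \<open>Kernels and the uniform Roe algebra\<close>

definition pos_def_kernel_real :: "'a set \<Rightarrow> ('a \<Rightarrow> 'a \<Rightarrow> real) \<Rightarrow> bool" where
  "pos_def_kernel_real X k \<longleftrightarrow>
     (\<forall>(n::nat) (x :: nat \<Rightarrow> 'a) (c :: nat \<Rightarrow> real). (\<forall>i<n. x i \<in> X) \<longrightarrow>
        (\<Sum>i<n. \<Sum>j<n. c i * c j * k (x i) (x j)) \<ge> 0)"

definition pos_def_kernel_complex :: "'a set \<Rightarrow> ('a \<Rightarrow> 'a \<Rightarrow> complex) \<Rightarrow> bool" where
  "pos_def_kernel_complex X k \<longleftrightarrow>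
     (\<forall>(n::nat) (x :: nat \<Rightarrow> 'a) (c :: nat \<Rightarrow> complex). (\<forall>i<n. x i \<in> X) \<longrightarrow>
        (\<Sum>i<n. \<Sum>j<n. c i * cnj (c j) * k (x i) (x j)) \<in> \<real>\<^sub>\<ge>\<^sub>0)"

text \<open>Operators on \<open>\<ell>\<^sup>2(X)\<close> are total functions of which only the values on
  \<open>lp_space 2 X\<close> matter.\<close>

definition l2_bounded_operator ::
    "'a set \<Rightarrow> (('a \<Rightarrow> complex) \<Rightarrow> ('a \<Rightarrow> complex)) \<Rightarrow> bool" where
  "l2_bounded_operator X S \<longleftrightarrow>
     (\<forall>f\<in>lp_space 2 X. S f \<in> lp_space 2 X) \<and>
     (\<forall>f\<in>lp_space 2 X. \<forall>g\<in>lp_space 2 X. S (\<lambda>x. f x + g x) = (\<lambda>x. S f x + S g x)) \<and>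
     (\<forall>f\<in>lp_space 2 X. \<forall>a. S (\<lambda>x. a * f x) = (\<lambda>x. a * S f x)) \<and>
     (\<exists>C. \<forall>f\<in>lp_space 2 X. lp_norm 2 X (S f) \<le> C * lp_norm 2 X f)"

definition l2_onorm :: "'a set \<Rightarrow> (('a \<Rightarrow> complex) \<Rightarrow> ('a \<Rightarrow> complex)) \<Rightarrow> real" where
  "l2_onorm X S = (SUP f\<in>{f \<in> lp_space 2 X. lp_norm 2 X f \<le> 1}. lp_norm 2 X (S f))"

definition finite_propagation ::
    "'a set \<Rightarrow> ('a \<Rightarrow> 'a \<Rightarrow> real \<Rightarrow> real) \<Rightarrow> (('a \<Rightarrow> complex) \<Rightarrow> ('a \<Rightarrow> complex)) \<Rightarrow> bool" where
  "finite_propagation X M S \<longleftrightarrow>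
     (\<exists>t>0. \<exists>r\<in>{0<..<1}. \<forall>x\<in>X. \<forall>y\<in>X.
        M x y t < 1 - r \<longrightarrow> l2_inner X (S (delta y)) (delta x) = 0)"

definition uniform_roe_algebra ::
    "'a set \<Rightarrow> ('a \<Rightarrow> 'a \<Rightarrow> real \<Rightarrow> real) \<Rightarrow> (('a \<Rightarrow> complex) \<Rightarrow> ('a \<Rightarrow> complex)) set" where
  "uniform_roe_algebra X M = {S. l2_bounded_operator X S \<and>
     (\<forall>e>0. \<exists>S'. l2_bounded_operator X S' \<and> finite_propagation X M S' \<and>
        l2_onorm X (\<lambda>f x. S f x - S' f x) < e)}"

definition kernel_operator ::
    "'a set \<Rightarrow> ('a \<Rightarrow> 'a \<Rightarrow> complex) \<Rightarrow> ('a \<Rightarrow> complex) \<Rightarrow> ('a \<Rightarrow> complex)" where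
  "kernel_operator X k f = (\<lambda>x. if x \<in> X then \<Sum>\<^sub>\<infinity>y\<in>X. k x y * f y else 0)"


section \<open>The analytic conditions\<close>

definition lp_condition :: "nat \<Rightarrow> 'a set \<Rightarrow> ('a \<Rightarrow> 'a \<Rightarrow> real \<Rightarrow> real) \<Rightarrow> bool" where
  "lp_condition p X M \<longleftrightarrow>
     (\<forall>\<epsilon>>0. \<forall>r\<in>{0<..<1}. \<forall>t>0.
        \<exists>\<eta> :: 'a \<Rightarrow> 'a \<Rightarrow> complex.
          (\<forall>x\<in>X. \<eta> x \<in> lp_space p X) \<and>
          (\<forall>x\<in>X. lp_norm p X (\<eta> x) = 1) \<and>
          (\<forall>x\<in>X. \<forall>y\<in>X. M x y t > 1 - r \<longrightarrow> lp_norm p X (\<lambda>z. \<eta> x z - \<eta> y z) < \<epsilon>) \<and>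
          (\<exists>R\<in>{0<..<1}. \<exists>T>0. \<forall>x\<in>X. {z \<in> X. \<eta> x z \<noteq> 0} \<subseteq> fball X M x R T))"

text \<open>The type argument is the type from which the elements of the Hilbert spaces are drawn:
  HOL cannot quantify existentially over all Hilbert spaces at once.\<close>

definition hilbert_condition ::
    "'h itself \<Rightarrow> 'a set \<Rightarrow> ('a \<Rightarrow> 'a \<Rightarrow> real \<Rightarrow> real) \<Rightarrow> bool" where
  "hilbert_condition _ X M \<longleftrightarrow>
     (\<forall>\<epsilon>>0. \<forall>r\<in>{0<..<1}. \<forall>t>0.
        \<exists>(H :: 'h set) zero add smul ip. complex_hilbert_space H zero add smul ip \<and>
        (\<exists>\<eta> :: 'a \<Rightarrow> 'h.
          (\<forall>x\<in>X. \<eta> x \<in> H) \<and>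
          (\<forall>x\<in>X. hilbert_norm ip (\<eta> x) = 1) \<and>
          (\<forall>x\<in>X. \<forall>y\<in>X. M x y t > 1 - r \<longrightarrow> hilbert_dist add smul ip (\<eta> x) (\<eta> y) < \<epsilon>) \<and>
          (\<exists>R\<in>{0<..<1}. \<exists>T>0. \<forall>x\<in>X. \<forall>y\<in>X. M x y T < 1 - R \<longrightarrow> ip (\<eta> x) (\<eta> y) = 0)))"

definition real_kernel_condition :: "'a set \<Rightarrow> ('a \<Rightarrow> 'a \<Rightarrow> real \<Rightarrow> real) \<Rightarrow> bool" where
  "real_kernel_condition X M \<longleftrightarrow>
     (\<forall>\<epsilon>>0. \<forall>r\<in>{0<..<1}. \<forall>t>0.
        \<exists>R\<in>{0<..<1}. \<exists>T>0. \<exists>k :: 'a \<Rightarrow> 'a \<Rightarrow> real.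
          pos_def_kernel_real X k \<and>
          (\<forall>x\<in>X. \<forall>y\<in>X. M x y t > 1 - r \<longrightarrow> \<bar>1 - k x y\<bar> < \<epsilon>) \<and>
          (\<forall>x\<in>X. \<forall>y\<in>X. M x y T < 1 - R \<longrightarrow> k x y = 0))"

text \<open>Summability is required explicitly because a divergent \<open>infsum\<close> has the junk value 0.\<close>

definition roe_kernel_condition :: "'a set \<Rightarrow> ('a \<Rightarrow> 'a \<Rightarrow> real \<Rightarrow> real) \<Rightarrow> bool" where
  "roe_kernel_condition X M \<longleftrightarrow>
     (\<forall>\<epsilon>>0. \<forall>r\<in>{0<..<1}. \<forall>t>0.
        \<exists>R\<in>{0<..<1}. \<exists>T>0. \<exists>k :: 'a \<Rightarrow> 'a \<Rightarrow> complex.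
          pos_def_kernel_complex X k \<and>
          (\<forall>x\<in>X. \<forall>y\<in>X. M x y t > 1 - r \<longrightarrow> cmod (1 - k x y) < \<epsilon>) \<and>
          (\<forall>x\<in>X. \<forall>y\<in>X. M x y T < 1 - R \<longrightarrow> k x y = 0) \<and>
          (\<forall>f\<in>lp_space 2 X. \<forall>x\<in>X. (\<lambda>y. k x y * f y) summable_on X) \<and>
          l2_bounded_operator X (kernel_operator X k) \<and>
          kernel_operator X k \<in> uniform_roe_algebra X M)"

end

theory Submission
  imports Defs "HOL-Computational_Algebra.Polynomial"
begin

text \<open>
  Since the t-norm has no zero divisors, closeness at a fixed scale composes to closeness at another
  scale, so balls behave like those of a bounded geometry metric space. Conditions (i)--(iii) are
  compared by discretising, respectively by taking roots and powers of, functions whose supports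
  lie in balls of uniformly bounded cardinality. Inner products of the vectors in (iv) give the
  kernel in (v), and a band kernel acts boundedly by Schur's test and has finite propagation, whence (vi).

  The essential step leads from a positive definite band kernel \<open>K\<close> back to vectors in
  \<open>\<ell>\<^sup>2(X)\<close> with supports in balls: one needs an approximate square root of \<open>K\<close> that again
  has finite propagation. After rescaling, \<open>U = 1 - K\<close> is a positive contraction, and with
  \<open>Y\<^sub>0 = 0\<close>, \<open>Y\<^sub>n\<^sub>+\<^sub>1 = (U + Y\<^sub>n\<^sup>2) / 2\<close> one has
  \<open>(1 - Y\<^sub>n)\<^sup>2 = K + 2 (Y\<^sub>n\<^sub>+\<^sub>1 - Y\<^sub>n)\<close>. The error \<open>Y\<^sub>n\<^sub>+\<^sub>1 - Y\<^sub>n\<close> is a polynomial in \<open>U\<close> with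
  nonnegative coefficients, so its matrix entries are at most its value at \<open>1\<close>, which tends to
  \<open>0\<close>. This makes the spectral theorem unnecessary, and everything happens on finitely
  supported functions.
\<close>

section \<open>Approximate square roots of positive band kernels\<close>

definition fsupp :: "('a \<Rightarrow> real) \<Rightarrow> 'a set" where
  "fsupp f = {z. f z \<noteq> 0}"

text \<open>Summing over the support of the first argument gives a finite sum as soon as that
  argument is finitely supported, whatever the second one is. Symmetry requires both supports to be
  finite, since a sum over an infinite set defaults to 0.\<close>

definition fip :: "('a \<Rightarrow> real) \<Rightarrow> ('a \<Rightarrow> real) \<Rightarrow> real" where
  "fip f g = (\<Sum>z\<in>fsupp f. f z * g z)"

definition point_mass :: "'a \<Rightarrow> 'a \<Rightarrow> real" where
  "point_mass x = (\<lambda>z. if z = x then 1 else 0)"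

lemma fip_eq_sum:
  assumes "finite F" "fsupp f \<subseteq> F"
  shows "fip f g = (\<Sum>z\<in>F. f z * g z)"
  unfolding fip_def using assms
  by (intro sum.mono_neutral_left) (auto simp: fsupp_def)

lemma fip_commute:
  assumes "finite (fsupp f)" "finite (fsupp g)"
  shows "fip f g = fip g f"
  using fip_eq_sum[of "fsupp f \<union> fsupp g" f g] fip_eq_sum[of "fsupp f \<union> fsupp g" g f] assms
  by (simp add: mult.commute)

lemma finite_fsupp_diff:
  "finite (fsupp f) \<Longrightarrow> finite (fsupp g) \<Longrightarrow> finite (fsupp (\<lambda>x. f x - c * g x))"
  by (rule finite_subset[of _ "fsupp f \<union> fsupp g"]) (auto simp: fsupp_def)

lemma fip_diff_left:
  assumes "finite (fsupp f)" "finite (fsupp g)"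
  shows "fip (\<lambda>x. f x - c * g x) h = fip f h - c * fip g h"
proof -
  let ?F = "fsupp f \<union> fsupp g"
  have "fip (\<lambda>x. f x - c * g x) h = (\<Sum>z\<in>?F. (f z - c * g z) * h z)"
    by (rule fip_eq_sum) (use assms in \<open>auto simp: fsupp_def\<close>)
  moreover have "fip f h = (\<Sum>z\<in>?F. f z * h z)" "fip g h = (\<Sum>z\<in>?F. g z * h z)"
    by (rule fip_eq_sum; use assms in auto)+
  ultimately show ?thesis
    by (simp add: sum_subtractf sum_distrib_left algebra_simps)
qed

lemma fip_diff_right:
  assumes "finite (fsupp f)"
  shows "fip f (\<lambda>x. g x - c * h x) = fip f g - c * fip f h"
  by (simp add: fip_def sum_subtractf sum_distrib_left algebra_simps)

lemma fip_sum_left: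
  assumes "finite I" "\<And>i. i \<in> I \<Longrightarrow> finite (fsupp (f i))"
  shows "fip (\<lambda>z. \<Sum>i\<in>I. c i * f i z) g = (\<Sum>i\<in>I. c i * fip (f i) g)"
proof -
  let ?F = "\<Union>i\<in>I. fsupp (f i)"
  have fin: "finite ?F" using assms by auto
  have "fsupp (\<lambda>z. \<Sum>i\<in>I. c i * f i z) \<subseteq> ?F"
    by (auto simp: fsupp_def intro: sum.neutral)
  from fip_eq_sum[OF fin this]
  have "fip (\<lambda>z. \<Sum>i\<in>I. c i * f i z) g = (\<Sum>z\<in>?F. \<Sum>i\<in>I. c i * f i z * g z)"
    by (simp add: sum_distrib_right)
  also have "\<dots> = (\<Sum>i\<in>I. \<Sum>z\<in>?F. c i * f i z * g z)"
    by (rule sum.swap)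
  also have "\<dots> = (\<Sum>i\<in>I. c i * fip (f i) g)"
    by (intro sum.cong refl, subst fip_eq_sum[OF fin])
       (auto simp: sum_distrib_left mult.assoc)
  finally show ?thesis .
qed

lemma fip_sum_right:
  "fip f (\<lambda>z. \<Sum>i\<in>I. c i * g i z) = (\<Sum>i\<in>I. c i * fip f (g i))"
proof -
  have "fip f (\<lambda>z. \<Sum>i\<in>I. c i * g i z) = (\<Sum>z\<in>fsupp f. \<Sum>i\<in>I. c i * (f z * g i z))"
    by (simp add: fip_def sum_distrib_left mult_ac)
  also have "\<dots> = (\<Sum>i\<in>I. c i * fip f (g i))"
    by (subst sum.swap) (simp add: fip_def sum_distrib_left)
  finally show ?thesis .
qed

lemma fip_point_mass_left [simp]: "fip (point_mass x) f = f x"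
  by (subst fip_eq_sum[of "{x}"]) (auto simp: fsupp_def point_mass_def)

lemma finite_fsupp_point_mass [simp]: "finite (fsupp (point_mass x))"
  by (rule finite_subset[of _ "{x}"]) (auto simp: fsupp_def point_mass_def)

text \<open>Later turns norm bounds into bounds on single matrix entries.\<close>

lemma square_le_fip_self:
  assumes "finite (fsupp f)"
  shows "(f y)\<^sup>2 \<le> fip f f"
proof -
  have "(f y)\<^sup>2 = (\<Sum>z\<in>{y}. f z * f z)" by (simp add: power2_eq_square)
  \<comment> \<open>Inserting y covers the case \<open>f y = 0\<close>.\<close>
  also have "\<dots> \<le> (\<Sum>z\<in>insert y (fsupp f). f z * f z)"
    by (rule sum_mono2) (use assms in auto)
  also have "\<dots> = fip f f"
    by (rule fip_eq_sum[symmetric]) (use assms in auto)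
  finally show ?thesis .
qed

section \<open>Polynomials approximating \<open>1 - sqrt (1 - u)\<close>\<close>

text \<open>On \<open>[0, 1]\<close> the values at \<open>u\<close> increase to \<open>1 - sqrt (1 - u)\<close>.\<close>

fun sqrt_poly :: "nat \<Rightarrow> real poly" where
  "sqrt_poly 0 = 0"
| "sqrt_poly (Suc n) = smult (1/2) ([:0, 1:] + sqrt_poly n * sqrt_poly n)"

text \<open>A condition on coefficients rather than on values over [0, 1]: it is stable under sums
  and products, and it lets the entries of q(U) be bounded termwise by q(1).\<close>

definition nonneg_coeffs :: "real poly \<Rightarrow> bool" where
  "nonneg_coeffs p \<longleftrightarrow> (\<forall>m. coeff p m \<ge> 0)"

lemma nonneg_coeffs_add: "nonneg_coeffs p \<Longrightarrow> nonneg_coeffs q \<Longrightarrow> nonneg_coeffs (p + q)"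
  by (simp add: nonneg_coeffs_def)

lemma nonneg_coeffs_smult: "c \<ge> 0 \<Longrightarrow> nonneg_coeffs p \<Longrightarrow> nonneg_coeffs (smult c p)"
  by (simp add: nonneg_coeffs_def)

lemma nonneg_coeffs_mult: "nonneg_coeffs p \<Longrightarrow> nonneg_coeffs q \<Longrightarrow> nonneg_coeffs (p * q)"
  by (simp add: nonneg_coeffs_def coeff_mult sum_nonneg)

lemma nonneg_coeffs_X: "nonneg_coeffs [:0, 1:]"
  by (simp add: nonneg_coeffs_def coeff_pCons split: nat.split)

lemma nonneg_coeffs_sqrt_poly: "nonneg_coeffs (sqrt_poly n)"
proof (induction n)
  case 0
  then show ?case by (simp add: nonneg_coeffs_def)
next
  case (Suc n)
  then show ?case
    unfolding sqrt_poly.simps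
    by (intro nonneg_coeffs_smult nonneg_coeffs_add nonneg_coeffs_mult nonneg_coeffs_X) auto
qed

text \<open>Induction along the factorisation Y' - Y = (Y - Z)(Y + Z) / 2 for three successive
  iterates Z, Y, Y'; both factors have nonnegative coefficients.\<close>

lemma nonneg_coeffs_sqrt_poly_step: "nonneg_coeffs (sqrt_poly (Suc n) - sqrt_poly n)"
proof (induction n)
  case 0
  show ?case by (auto simp: nonneg_coeffs_def coeff_pCons split: nat.split)
next
  case (Suc n)
  let ?Y = "sqrt_poly (Suc n)" and ?Z = "sqrt_poly n"
  have "(?Y - ?Z) * (?Y + ?Z) = ([:0, 1:] + ?Y * ?Y) - ([:0, 1:] + ?Z * ?Z)"
    by (simp add: algebra_simps del: sqrt_poly.simps)
  then have "smult (1/2) ((?Y - ?Z) * (?Y + ?Z)) =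
      smult (1/2) ([:0, 1:] + ?Y * ?Y) - smult (1/2) ([:0, 1:] + ?Z * ?Z)"
    by (simp only: smult_diff_right)
  also have "\<dots> = sqrt_poly (Suc (Suc n)) - ?Y"
    by (rule arg_cong2[of _ _ _ _ "(-)"]; rule sqrt_poly.simps(2)[symmetric])
  finally have "sqrt_poly (Suc (Suc n)) - ?Y = smult (1/2) ((?Y - ?Z) * (?Y + ?Z))" ..
  then show ?case
    using Suc
    by (simp only:) (intro nonneg_coeffs_smult nonneg_coeffs_mult nonneg_coeffs_add
          nonneg_coeffs_sqrt_poly; simp)
qed

lemma poly_1_eq_sum_coeffs:
  fixes p :: "real poly"
  assumes "degree p \<le> D"
  shows "poly p 1 = (\<Sum>m\<le>D. coeff p m)"
proof -
  have "(\<Sum>m\<le>D. coeff p m) = (\<Sum>m\<le>degree p. coeff p m)"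
    by (rule sum.mono_neutral_right) (use assms in \<open>auto simp: coeff_eq_0\<close>)
  then show ?thesis by (simp add: poly_altdef)
qed

text \<open>The values at 1 increase and are at most 1, hence converge, so consecutive differences
  tend to 0.\<close>

lemma sqrt_poly_step_small:
  assumes "e > 0"
  shows "\<exists>n. poly (sqrt_poly (Suc n) - sqrt_poly n) 1 < e"
proof -
  let ?y = "\<lambda>n. poly (sqrt_poly n) 1"
  have nonneg: "poly p 1 \<ge> 0" if "nonneg_coeffs p" for p
    using that by (simp add: poly_altdef nonneg_coeffs_def sum_nonneg)
  have le1: "?y n \<le> 1" for n
  proof (induction n)
    case (Suc n)
    have "?y n * ?y n \<le> 1 * 1"
      by (intro mult_mono Suc nonneg nonneg_coeffs_sqrt_poly) auto
    then show ?case by simp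
  qed simp
  have inc: "incseq ?y"
    using nonneg[OF nonneg_coeffs_sqrt_poly_step] by (intro incseq_SucI) (simp only: poly_diff, simp)
  obtain l where l: "?y \<longlonglongrightarrow> l"
    by (rule incseq_convergent[OF inc, of 1]) (use le1 in auto)
  have "(\<lambda>n. ?y (Suc n) - ?y n) \<longlonglongrightarrow> l - l"
    by (intro tendsto_diff l LIMSEQ_Suc)
  then have "eventually (\<lambda>n. ?y (Suc n) - ?y n < e) sequentially"
    using assms by (intro order_tendstoD(2)) auto
  then obtain n where "?y (Suc n) - ?y n < e"
    by (auto simp: eventually_sequentially)
  then show ?thesis by (intro exI[of _ n]) (simp only: poly_diff)
qed

text \<open>Substitute Y_n^2 = 2 Y_{n+1} - u into 1 - 2 Y_n + Y_n^2. At u = U the term 1 - u becomes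
  the rescaled kernel, and the rest is the error.\<close>

lemma one_minus_sqrt_poly_square:
  "(1 - sqrt_poly n) * (1 - sqrt_poly n) =
     [:1, -1:] + smult 2 (sqrt_poly (Suc n) - sqrt_poly n)"
proof -
  have "smult 2 (sqrt_poly (Suc n)) = [:0, 1:] + sqrt_poly n * sqrt_poly n"
    by (simp add: smult_add_right)
  moreover have "[:1, -1:] = 1 - [:0, 1 :: real:]"
    by (simp add: one_pCons)
  moreover have "smult 2 q = q + q" for q :: "real poly"
    by (metis one_add_one smult_1_left smult_add_left)
  ultimately show ?thesis
    by (simp add: smult_diff_right algebra_simps del: sqrt_poly.simps)
qed

section \<open>Operator calculus for a positive band kernel\<close>

text \<open>The kernel lives on the whole type; a kernel on X enters after extension by zero. The
  constants \<open>N\<close> and \<open>B\<close> provide the operator bound.\<close>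

locale psd_band_kernel =
  fixes K :: "'a \<Rightarrow> 'a \<Rightarrow> real" and N :: nat and B :: real
  assumes K_sym: "K x y = K y x"
    and K_psd: "finite F \<Longrightarrow> (\<Sum>x\<in>F. \<Sum>y\<in>F. f x * f y * K x y) \<ge> 0"
    and finite_row: "finite {y. K x y \<noteq> 0}"
    and card_row: "card {y. K x y \<noteq> 0} \<le> N"
    and K_bound: "\<bar>K x y\<bar> \<le> B"
begin

text \<open>By Schur's test B N bounds the operator with kernel K; the summand 1 keeps the divisor
  positive when B N = 0.\<close>

definition C :: real where "C = B * N + 1"

lemma B_nonneg: "B \<ge> 0"
  using K_bound[of undefined undefined] by linarith

lemma C_pos: "C > 0"
  using B_nonneg by (simp add: C_def add_nonneg_pos)

text \<open>Division by \<open>C\<close> yields an operator D with 0 \<le> D \<le> 1 as a quadratic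
  form on finitely supported functions.\<close>

definition K_op :: "('a \<Rightarrow> real) \<Rightarrow> 'a \<Rightarrow> real" where
  "K_op f = (\<lambda>x. (\<Sum>y\<in>fsupp f. K x y * f y) / C)"

definition U :: "('a \<Rightarrow> real) \<Rightarrow> 'a \<Rightarrow> real" where
  "U f = (\<lambda>x. f x - 1 * K_op f x)"  \<comment> \<open>the factor 1 matches the shape of \<open>fip_diff_left\<close>\<close>

lemma K_op_eq_sum:
  assumes "finite F" "fsupp f \<subseteq> F"
  shows "K_op f x = (\<Sum>y\<in>F. K x y * f y) / C"
proof -
  have "(\<Sum>y\<in>fsupp f. K x y * f y) = (\<Sum>y\<in>F. K x y * f y)"
    using assms by (intro sum.mono_neutral_left) (auto simp: fsupp_def)
  then show ?thesis by (simp add: K_op_def)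
qed

lemma fsupp_K_op: "fsupp (K_op f) \<subseteq> (\<Union>y\<in>fsupp f. {x. K y x \<noteq> 0})"
  by (auto simp: fsupp_def K_op_def K_sym intro: ccontr sum.neutral)
     (metis (mono_tags, lifting) mem_Collect_eq mult_eq_0_iff sum.neutral K_sym)

lemma finite_fsupp_K_op: "finite (fsupp f) \<Longrightarrow> finite (fsupp (K_op f))"
  by (rule finite_subset[OF fsupp_K_op]) (auto simp: finite_row)

lemma finite_fsupp_U: "finite (fsupp f) \<Longrightarrow> finite (fsupp (U f))"
  unfolding U_def by (intro finite_fsupp_diff finite_fsupp_K_op)

lemma fip_K_op:
  assumes "finite F" "fsupp f \<subseteq> F" "fsupp g \<subseteq> F"
  shows "fip f (K_op g) = (\<Sum>x\<in>F. \<Sum>y\<in>F. f x * g y * K x y) / C"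
  by (simp add: fip_eq_sum[OF assms(1,2)] K_op_eq_sum[OF assms(1,3)] sum_distrib_left
        sum_divide_distrib mult_ac)

lemma K_op_symmetric:
  assumes "finite (fsupp f)" "finite (fsupp g)"
  shows "fip (K_op f) g = fip f (K_op g)"
proof -
  let ?F = "fsupp f \<union> fsupp g"
  have "fip (K_op f) g = fip g (K_op f)"
    by (intro fip_commute finite_fsupp_K_op assms)
  also have "\<dots> = (\<Sum>x\<in>?F. \<Sum>y\<in>?F. g x * f y * K x y) / C"
    by (rule fip_K_op) (use assms in auto)
  also have "\<dots> = (\<Sum>y\<in>?F. \<Sum>x\<in>?F. g x * f y * K x y) / C"
    by (subst sum.swap) simp
  also have "\<dots> = fip f (K_op g)"
    by (subst fip_K_op[of ?F]) (use assms in \<open>auto simp: K_sym mult_ac\<close>)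
  finally show ?thesis .
qed

lemma K_op_nonneg:
  assumes "finite (fsupp f)"
  shows "fip f (K_op f) \<ge> 0"
  using fip_K_op[OF assms order_refl order_refl] K_psd[OF assms, of f] C_pos by simp

text \<open>Schur's test in symmetric form: 2 |f x f y| \<le> (f x)^2 + (f y)^2 is applied to the
  nonzero entries only, of which each row has at most \<open>N\<close>.\<close>

lemma K_op_le:
  assumes "finite (fsupp f)"
  shows "fip f (K_op f) \<le> fip f f"
proof -
  let ?F = "fsupp f"
  let ?E = "\<lambda>x. {y \<in> ?F. K x y \<noteq> 0}"
  have card: "real (card (?E x)) \<le> N" for x
    using card_mono[OF finite_row, of "?E x" x] card_row[of x] by (simp add: subset_iff)
  have row: "(\<Sum>y\<in>?F. if K x y = 0 then 0 else c) \<le> N * c" if "c \<ge> 0" for x and c :: real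
  proof -
    have "(\<Sum>y\<in>?F. if K x y = 0 then 0 else c) = (\<Sum>y\<in>?E x. c)"
      using assms by (intro sum.mono_neutral_cong_right) auto
    also have "\<dots> \<le> N * c" using card[of x] that by (simp add: mult_right_mono)
    finally show ?thesis .
  qed
  \<comment> \<open>The case distinctions ensure that a row is charged only for its nonzero
    entries.\<close>
  have pt: "f x * f y * K x y \<le> (if K x y = 0 then 0 else B * (f x)\<^sup>2 / 2) +
             (if K x y = 0 then 0 else B * (f y)\<^sup>2 / 2)" for x y
  proof -
    have "f x * f y * K x y \<le> \<bar>f x * f y\<bar> * \<bar>K x y\<bar>"
      by (metis abs_ge_self abs_mult)
    also have "\<dots> \<le> (((f x)\<^sup>2 + (f y)\<^sup>2) / 2) * B"
      using sum_squares_bound[of "\<bar>f x\<bar>" "\<bar>f y\<bar>"] K_bound[of x y]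
      by (intro mult_mono) (auto simp: abs_mult)
    finally show ?thesis by (auto simp: field_simps)
  qed
  have half: "(\<Sum>x\<in>?F. \<Sum>y\<in>?F. if K x y = 0 then 0 else B * (f x)\<^sup>2 / 2) \<le> B * N * fip f f / 2"
  proof -
    have "(\<Sum>x\<in>?F. \<Sum>y\<in>?F. if K x y = 0 then 0 else B * (f x)\<^sup>2 / 2)
      \<le> (\<Sum>x\<in>?F. N * (B * (f x)\<^sup>2 / 2))"
      by (intro sum_mono row) (use B_nonneg in auto)
    also have "\<dots> = B * N * fip f f / 2"
      by (simp add: fip_def sum_distrib_left sum_divide_distrib power2_eq_square mult_ac)
    finally show ?thesis .
  qed
  have "(\<Sum>x\<in>?F. \<Sum>y\<in>?F. f x * f y * K x y) \<le>
    (\<Sum>x\<in>?F. \<Sum>y\<in>?F. (if K x y = 0 then 0 else B * (f x)\<^sup>2 / 2) +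
             (if K x y = 0 then 0 else B * (f y)\<^sup>2 / 2))"
    by (intro sum_mono pt)
  also have "\<dots> = (\<Sum>x\<in>?F. \<Sum>y\<in>?F. if K x y = 0 then 0 else B * (f x)\<^sup>2 / 2) +
       (\<Sum>x\<in>?F. \<Sum>y\<in>?F. if K x y = 0 then 0 else B * (f y)\<^sup>2 / 2)"
    by (simp add: sum.distrib)
  \<comment> \<open>Symmetry of K identifies the column half with the row half.\<close>
  also have "(\<Sum>x\<in>?F. \<Sum>y\<in>?F. if K x y = 0 then 0 else B * (f y)\<^sup>2 / 2) =
     (\<Sum>x\<in>?F. \<Sum>y\<in>?F. if K x y = 0 then 0 else B * (f x)\<^sup>2 / 2)"
    by (subst sum.swap) (simp add: K_sym)
  finally have "(\<Sum>x\<in>?F. \<Sum>y\<in>?F. f x * f y * K x y) \<le> B * N * fip f f"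
    using half by simp
  also have "\<dots> \<le> C * fip f f"
    by (simp add: C_def fip_def algebra_simps sum_nonneg)
  finally show ?thesis
    using fip_K_op[OF assms order_refl order_refl] C_pos by (simp add: pos_divide_le_eq mult.commute)
qed

text \<open>\<open>K_op\<close> sums over the support of its argument, and that of
  \<open>U f\<close> may shrink by cancellation; linearity is therefore checked on a common finite
  set.\<close>

lemma K_op_U:
  assumes "finite (fsupp f)"
  shows "K_op (U f) = (\<lambda>x. K_op f x - 1 * K_op (K_op f) x)"
proof -
  let ?F = "fsupp f \<union> fsupp (K_op f)"
  have F: "finite ?F" by (simp add: assms finite_fsupp_K_op)
  have sub: "fsupp (U f) \<subseteq> ?F" by (auto simp: fsupp_def U_def)
  show ?thesis
  proof
    fix x
    have "K_op (U f) x = (\<Sum>y\<in>?F. K x y * f y - K x y * K_op f y) / C"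
      unfolding K_op_eq_sum[OF F sub] by (simp add: U_def right_diff_distrib)
    also have "\<dots> = (\<Sum>y\<in>?F. K x y * f y) / C - (\<Sum>y\<in>?F. K x y * K_op f y) / C"
      by (simp add: sum_subtractf diff_divide_distrib)
    also have "\<dots> = K_op f x - 1 * K_op (K_op f) x"
      using K_op_eq_sum[OF F Un_upper1, of x] K_op_eq_sum[OF F Un_upper2, of x] by simp
    finally show "K_op (U f) x = K_op f x - 1 * K_op (K_op f) x" .
  qed
qed

lemma U_symmetric:
  assumes "finite (fsupp f)" "finite (fsupp g)"
  shows "fip (U f) g = fip f (U g)"
  using K_op_symmetric[OF assms]
  by (simp only: U_def fip_diff_left[OF assms(1) finite_fsupp_K_op[OF assms(1)]]
        fip_diff_right[OF assms(1)])

text \<open>With \<open>D = 1 - U\<close>: adding \<open>\<langle>D U f, U f\<rangle> \<ge> 0\<close> and \<open>\<langle>D f, D f\<rangle> \<ge> \<langle>D D f, D f\<rangle>\<close> gives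
  \<open>\<langle>D f, D f\<rangle> \<le> \<langle>D f, f\<rangle>\<close>.\<close>

lemma U_contraction:
  assumes f: "finite (fsupp f)"
  shows "fip (U f) (U f) \<le> fip f f"
proof -
  let ?D = K_op
  note Df = finite_fsupp_K_op[OF f]
  note DDf = finite_fsupp_K_op[OF Df]
  have comm: "fip (?D f) f = fip f (?D f)" by (rule K_op_symmetric[OF f f])
  have comm2: "fip f (?D (?D f)) = fip (?D f) (?D f)"
    by (rule K_op_symmetric[OF f Df, symmetric])
  have "0 \<le> fip (U f) (?D (U f))" by (intro K_op_nonneg finite_fsupp_U f)
  also have "\<dots> = fip f (?D f) - fip (?D f) (?D f) - (fip (?D f) (?D f) - fip (?D f) (?D (?D f)))"
    unfolding K_op_U[OF f] unfolding U_def
    by (simp only: fip_diff_left[OF f Df] fip_diff_right[OF f] fip_diff_right[OF Df] comm2, simp)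
  finally have "fip (?D f) (?D f) \<le> fip f (?D f)"
    using K_op_le[OF Df] by linarith
  moreover have "fip (U f) (U f) = fip f f - fip f (?D f) - (fip f (?D f) - fip (?D f) (?D f))"
    unfolding U_def
    by (simp only: fip_diff_left[OF f Df] fip_diff_right[OF f] fip_diff_right[OF Df] comm, simp)
  \<comment> \<open>The expansion \<langle>f, f\<rangle> - 2 \<langle>f, D f\<rangle> + \<langle>D
    f, D f\<rangle> is thus at most \<langle>f, f\<rangle> - \<langle>f, D f\<rangle>.\<close>
  ultimately show ?thesis using K_op_nonneg[OF f] by linarith
qed

lemma finite_fsupp_U_pow: "finite (fsupp f) \<Longrightarrow> finite (fsupp ((U ^^ m) f))"
  by (induction m) (auto intro: finite_fsupp_U)

lemma U_pow_contraction:
  assumes "finite (fsupp f)"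
  shows "fip ((U ^^ m) f) ((U ^^ m) f) \<le> fip f f"
  by (induction m) (auto intro: order_trans[OF U_contraction] finite_fsupp_U_pow[OF assms])

text \<open>Symmetry of U makes the pairing depend on i + j only, so that Gram entries of p(U)
  become entries of the polynomial p^2 in U.\<close>

lemma fip_U_pow:
  assumes "finite (fsupp f)" "finite (fsupp g)"
  shows "fip ((U ^^ i) f) ((U ^^ j) g) = fip ((U ^^ (i + j)) f) g"
proof (induction j arbitrary: i)
  case (Suc j)
  have "fip ((U ^^ i) f) ((U ^^ Suc j) g) = fip ((U ^^ Suc i) f) ((U ^^ j) g)"
    using U_symmetric[OF finite_fsupp_U_pow[OF assms(1)] finite_fsupp_U_pow[OF assms(2)]]
    by simp
  then show ?case by (simp only: Suc.IH) simp
qed simp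

text \<open>Point masses are unit vectors and U does not increase norms, so no matrix entry of a
  power of U exceeds 1.\<close>

lemma abs_U_pow_le_1: "\<bar>(U ^^ m) (point_mass x) y\<bar> \<le> 1"
proof -
  have "((U ^^ m) (point_mass x) y)\<^sup>2 \<le> fip (point_mass x) (point_mass x)"
    by (rule order_trans[OF square_le_fip_self U_pow_contraction]) (auto intro: finite_fsupp_U_pow)
  also have "\<dots> = 1" by (subst fip_point_mass_left) (simp add: point_mass_def)
  finally show ?thesis by (simp add: abs_square_le_1)
qed

text \<open>Each application of U spreads supports by at most one edge of the graph of nonzero
  entries of K. Shorter paths occur because the identity part of U leaves the support in
  place.\<close>

lemma fsupp_U_pow:
  "fsupp ((U ^^ m) (point_mass x)) \<subseteq> (\<Union>i\<le>m. {z. ((\<lambda>x y. K x y \<noteq> 0) ^^ i) x z})"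
proof (induction m)
  case 0
  then show ?case by (auto simp: fsupp_def point_mass_def split: if_splits)
next
  case (Suc m)
  let ?g = "(U ^^ m) (point_mass x)"
  have "fsupp (U ?g) \<subseteq> fsupp ?g \<union> fsupp (K_op ?g)"
    by (auto simp: fsupp_def U_def)
  also have "\<dots> \<subseteq> fsupp ?g \<union> (\<Union>y\<in>fsupp ?g. {x. K y x \<noteq> 0})"
    using fsupp_K_op by blast
  also have "\<dots> \<subseteq> (\<Union>i\<le>Suc m. {z. ((\<lambda>x y. K x y \<noteq> 0) ^^ i) x z})"
  proof -
    { fix z assume "z \<in> fsupp ?g"
      then obtain i where "i \<le> m" "((\<lambda>x y. K x y \<noteq> 0) ^^ i) x z" using Suc by auto
      then have "z \<in> (\<Union>i\<le>Suc m. {z. ((\<lambda>x y. K x y \<noteq> 0) ^^ i) x z})" by (auto intro!: bexI[of _ i]) }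
    moreover
    { fix z w assume "z \<in> fsupp ?g" and zw: "K z w \<noteq> 0"
      then obtain i where "i \<le> m" "((\<lambda>x y. K x y \<noteq> 0) ^^ i) x z" using Suc by auto
      with zw have "w \<in> (\<Union>i\<le>Suc m. {z. ((\<lambda>x y. K x y \<noteq> 0) ^^ i) x z})"
        by (auto intro!: bexI[of _ "Suc i"]) }
    ultimately show ?thesis by blast
  qed
  finally show ?case by simp
qed

text \<open>The vectors are \<open>sqrt C\<close> times p(U) applied to point masses, with p = 1 -
  \<open>sqrt_poly n\<close>. Their Gram matrix is C p(U)^2 = K + 2 C q(U), where q is one increment
  of the iteration. Path lengths are bounded by the degree of p, uniformly in x.\<close>

theorem approximate_square_root:
  assumes "e > 0"
  shows "\<exists>n \<zeta>. (\<forall>x. finite (fsupp (\<zeta> x)) \<and>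
             fsupp (\<zeta> x) \<subseteq> (\<Union>i\<le>n. {z. ((\<lambda>x y. K x y \<noteq> 0) ^^ i) x z})) \<and>
           (\<forall>x y. \<bar>fip (\<zeta> x) (\<zeta> y) - K x y\<bar> < e)"
proof -
  \<comment> \<open>The tolerance compensates for the factor 2 C in front of the error.\<close>
  obtain n where n: "poly (sqrt_poly (Suc n) - sqrt_poly n) 1 < e / (2 * C)"
    using sqrt_poly_step_small[of "e / (2 * C)"] assms C_pos by auto
  define p where "p = 1 - sqrt_poly n"
  define q where "q = sqrt_poly (Suc n) - sqrt_poly n"
  define d where "d = degree p"
  \<comment> \<open>D dominates every exponent i + j \<le> 2 d, the degree of q, and the degree 1 of
    \<open>[:1, -1:]\<close>.\<close>
  define D where "D = 2 * d + 1 + degree q"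
  define v where "v x m = (U ^^ m) (point_mass x)" for x m
  \<comment> \<open>The factor \<open>sqrt C\<close> undoes the division by \<open>C\<close> in
    \<open>K_op\<close>.\<close>
  define \<zeta> where "\<zeta> x = (\<lambda>z. \<Sum>i\<le>d. (sqrt C * coeff p i) * v x i z)" for x
  have fin_v: "finite (fsupp (v x i))" for x i
    unfolding v_def by (rule finite_fsupp_U_pow) simp
  have supp: "fsupp (\<zeta> x) \<subseteq> (\<Union>i\<le>d. fsupp (v x i))" for x
    by (auto simp: fsupp_def \<zeta>_def intro: sum.neutral)
  have "fsupp (\<zeta> x) \<subseteq> (\<Union>i\<le>d. {z. ((\<lambda>x y. K x y \<noteq> 0) ^^ i) x z})" for x
  proof -
    have "fsupp (v x i) \<subseteq> (\<Union>i\<le>d. {z. ((\<lambda>x y. K x y \<noteq> 0) ^^ i) x z})" if "i \<le> d" for i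
      using fsupp_U_pow[of i x] that unfolding v_def by force
    then show ?thesis using supp[of x] by blast
  qed
  moreover have "finite (fsupp (\<zeta> x))" for x
    by (rule finite_subset[OF supp]) (auto intro: fin_v)
  moreover have "\<bar>fip (\<zeta> x) (\<zeta> y) - K x y\<bar> < e" for x y
  proof -
    define u where "u m = v x m y" for m
    have u: "fip (v x i) (v y j) = u (i + j)" for i j
      using fip_U_pow[of "point_mass x" "point_mass y" i j]
        fip_commute[of "point_mass y" "v x (i + j)"] fin_v[of x "i + j"]
      by (simp add: v_def u_def)
    have "fip (\<zeta> x) (\<zeta> y) = (\<Sum>i\<le>d. \<Sum>j\<le>d. (sqrt C * coeff p i) * ((sqrt C * coeff p j) * u (i + j)))"
      unfolding \<zeta>_def
      by (subst fip_sum_left) (auto simp: fip_sum_right u fin_v sum_distrib_left)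
    also have "\<dots> = C * (\<Sum>i\<le>d. \<Sum>j\<le>d. coeff p i * coeff p j * u (i + j))"
    proof -
      have *: "(sqrt C * a) * ((sqrt C * b) * c) = C * (a * b * c)" for a b c
        using C_pos by (simp add: mult_ac)
      show ?thesis unfolding * by (simp add: sum_distrib_left)
    qed
    \<comment> \<open>The index square is enlarged to a triangle, where terms with i > d or j > d
      vanish; summing along diagonals then yields the Cauchy product.\<close>
    also have "(\<Sum>i\<le>d. \<Sum>j\<le>d. coeff p i * coeff p j * u (i + j)) =
               (\<Sum>(i,j)\<in>{(i,j). i + j \<le> D}. coeff p i * coeff p j * u (i + j))"
      unfolding sum.cartesian_product
    proof (rule sum.mono_neutral_left)
      show "finite {(i, j). i + j \<le> D}"
        by (rule finite_subset[of _ "{..D} \<times> {..D}"]) auto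
    qed (auto simp: D_def d_def intro: le_degree)
    also have "\<dots> = (\<Sum>m\<le>D. \<Sum>i\<le>m. coeff p i * coeff p (m - i) * u (i + (m - i)))"
      by (rule sum.triangle_reindex_eq)
    also have "\<dots> = (\<Sum>m\<le>D. coeff (p * p) m * u m)"
      by (simp add: coeff_mult sum_distrib_right)
    also have "p * p = [:1, -1:] + smult 2 q"
      unfolding p_def q_def by (rule one_minus_sqrt_poly_square)
    also have "(\<Sum>m\<le>D. coeff ([:1, -1:] + smult 2 q) m * u m) =
      (\<Sum>m\<le>D. coeff [:1, -1:] m * u m) + 2 * (\<Sum>m\<le>D. coeff q m * u m)"
      by (simp add: sum.distrib sum_distrib_left distrib_right mult.assoc)
    also have "(\<Sum>m\<le>D. coeff [:1, -1:] m * u m) = (\<Sum>m\<in>{0, 1}. coeff [:1, -1:] m * u m)"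
      by (rule sum.mono_neutral_right)
         (auto simp: D_def coeff_pCons split: nat.splits)
    also have "\<dots> = u 0 - u 1" by simp
    \<comment> \<open>The first two moments give (1 - U) applied to the point mass, which is the
      rescaled kernel.\<close>
    also have "\<dots> = K_op (point_mass x) y"
      by (simp add: u_def v_def U_def)
    also have "\<dots> = K x y / C"
      by (subst K_op_eq_sum[of "{x}"]) (auto simp: fsupp_def point_mass_def K_sym)
    finally have "fip (\<zeta> x) (\<zeta> y) - K x y = 2 * C * (\<Sum>m\<le>D. coeff q m * u m)"
      using C_pos by (simp add: distrib_left)
    moreover have "\<bar>\<Sum>m\<le>D. coeff q m * u m\<bar> \<le> poly q 1"
    proof -
      have "\<bar>\<Sum>m\<le>D. coeff q m * u m\<bar> \<le> (\<Sum>m\<le>D. \<bar>coeff q m * u m\<bar>)"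
        by (rule sum_abs)
      also have "\<dots> \<le> (\<Sum>m\<le>D. coeff q m * 1)"
      proof (rule sum_mono)
        fix m
        have "coeff q m \<ge> 0"
          using nonneg_coeffs_sqrt_poly_step[of n] unfolding q_def nonneg_coeffs_def by blast
        then show "\<bar>coeff q m * u m\<bar> \<le> coeff q m * 1"
          using abs_U_pow_le_1[of m x y]
          by (simp add: abs_mult u_def v_def mult_left_le del: sqrt_poly.simps)
      qed
      also have "\<dots> = poly q 1"
        by (subst poly_1_eq_sum_coeffs[of q D]) (auto simp: D_def)
      finally show ?thesis .
    qed
    ultimately have "\<bar>fip (\<zeta> x) (\<zeta> y) - K x y\<bar> \<le> 2 * C * poly q 1"
      using C_pos by (simp add: abs_mult)
    also have "\<dots> < e" using n C_pos by (simp only: q_def[symmetric]) (simp add: field_simps)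
    finally show ?thesis .
  qed
  ultimately show ?thesis by blast
qed

end

section \<open>The Hilbert space \<open>\<ell>\<^sup>2(X)\<close>\<close>

lemma lp_norm_2: "lp_norm 2 X f = sqrt (\<Sum>\<^sub>\<infinity>x\<in>X. (cmod (f x))\<^sup>2)"
  by (simp add: lp_norm_def sqrt_def)

lemma lp_norm_2_nonneg: "lp_norm 2 X f \<ge> 0"
  by (simp add: lp_norm_2 infsum_nonneg)

lemma lp_space_2_offD: "f \<in> lp_space 2 X \<Longrightarrow> x \<notin> X \<Longrightarrow> f x = 0"
  by (simp add: lp_space_def)

lemma finite_sum_le_lp_norm_2:
  assumes "f \<in> lp_space 2 X" "finite F" "F \<subseteq> X"
  shows "(\<Sum>x\<in>F. (cmod (f x))\<^sup>2) \<le> (lp_norm 2 X f)\<^sup>2"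
proof -
  have "(\<Sum>x\<in>F. (cmod (f x))\<^sup>2) \<le> (\<Sum>\<^sub>\<infinity>x\<in>X. (cmod (f x))\<^sup>2)"
    by (rule finite_sum_le_infsum) (use assms in \<open>auto simp: lp_space_def\<close>)
  then show ?thesis by (simp add: lp_norm_2 infsum_nonneg)
qed

text \<open>All terms are nonnegative, so the finite partial sums control both summability and norm.
  This reduces \<ell>^2 estimates to finite sums.\<close>

lemma lp_space_2I:
  assumes off: "\<And>x. x \<notin> X \<Longrightarrow> f x = 0"
    and bound: "\<And>F. finite F \<Longrightarrow> F \<subseteq> X \<Longrightarrow> (\<Sum>x\<in>F. (cmod (f x))\<^sup>2) \<le> c\<^sup>2"
    and "c \<ge> 0"
  shows "f \<in> lp_space 2 X" "lp_norm 2 X f \<le> c"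
proof -
  have s: "(\<lambda>x. (cmod (f x))\<^sup>2) summable_on X"
    by (rule nonneg_bdd_above_summable_on) (use bound in \<open>auto intro!: bdd_aboveI2[of _ _ "c\<^sup>2"]\<close>)
  with off show "f \<in> lp_space 2 X" by (simp add: lp_space_def)
  have "(\<Sum>\<^sub>\<infinity>x\<in>X. (cmod (f x))\<^sup>2) \<le> c\<^sup>2"
    by (rule infsum_le_finite_sums[OF s]) (use bound in auto)
  then show "lp_norm 2 X f \<le> c"
    using \<open>c \<ge> 0\<close> by (simp add: lp_norm_2 real_le_lsqrt)
qed

text \<open>Minkowski's inequality on each finite subset, with a bound independent of the
  subset.\<close>

lemma lp_norm_2_triangle:
  assumes f: "f \<in> lp_space 2 X" and g: "g \<in> lp_space 2 X"
  shows "(\<lambda>x. f x + g x) \<in> lp_space 2 X"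
    and "lp_norm 2 X (\<lambda>x. f x + g x) \<le> lp_norm 2 X f + lp_norm 2 X g"
proof -
  have bound: "(\<Sum>x\<in>F. (cmod (f x + g x))\<^sup>2) \<le> (lp_norm 2 X f + lp_norm 2 X g)\<^sup>2"
    if F: "finite F" "F \<subseteq> X" for F
  proof -
    have le: "L2_set (\<lambda>x. cmod (h x)) F \<le> lp_norm 2 X h" if "h \<in> lp_space 2 X" for h
      unfolding L2_set_def
      by (rule real_le_lsqrt) (use finite_sum_le_lp_norm_2[OF that F] lp_norm_2_nonneg in auto)
    have "L2_set (\<lambda>x. cmod (f x + g x)) F \<le> L2_set (\<lambda>x. cmod (f x) + cmod (g x)) F"
      by (rule L2_set_mono) (auto simp: norm_triangle_ineq)
    also have "\<dots> \<le> L2_set (\<lambda>x. cmod (f x)) F + L2_set (\<lambda>x. cmod (g x)) F"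
      by (rule L2_set_triangle_ineq)
    also have "\<dots> \<le> lp_norm 2 X f + lp_norm 2 X g"
      by (intro add_mono le f g)
    finally have "(L2_set (\<lambda>x. cmod (f x + g x)) F)\<^sup>2 \<le> (lp_norm 2 X f + lp_norm 2 X g)\<^sup>2"
      by (intro power_mono) auto
    then show ?thesis by (simp add: L2_set_def sum_nonneg)
  qed
  have off: "f x + g x = 0" if "x \<notin> X" for x
    using f g that by (simp add: lp_space_2_offD)
  have nn: "lp_norm 2 X f + lp_norm 2 X g \<ge> 0"
    by (simp add: lp_norm_2_nonneg)
  show "(\<lambda>x. f x + g x) \<in> lp_space 2 X"
    by (rule lp_space_2I(1)[OF off bound nn])
  show "lp_norm 2 X (\<lambda>x. f x + g x) \<le> lp_norm 2 X f + lp_norm 2 X g"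
    by (rule lp_space_2I(2)[OF off bound nn])
qed

lemma lp_space_2_cmult:
  assumes "f \<in> lp_space 2 X"
  shows "(\<lambda>x. a * f x) \<in> lp_space 2 X"
  using assms summable_on_cmult_right[of "\<lambda>x. (cmod (f x))\<^sup>2" X "(cmod a)\<^sup>2"]
  by (simp add: lp_space_def norm_mult power_mult_distrib)

lemma lp_space_2_diff:
  assumes "f \<in> lp_space 2 X" "g \<in> lp_space 2 X"
  shows "(\<lambda>x. f x - g x) \<in> lp_space 2 X"
  using lp_norm_2_triangle(1)[OF assms(1) lp_space_2_cmult[OF assms(2), of "-1"]] by simp

lemma l2_inner_summable:
  assumes "f \<in> lp_space 2 X" "g \<in> lp_space 2 X"
  shows "(\<lambda>x. f x * cnj (g x)) summable_on X"
proof (rule abs_summable_summable, rule abs_summable_product)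
  show "(\<lambda>x. norm (f x * f x)) summable_on X"
    using assms(1) by (simp add: lp_space_def norm_mult power2_eq_square)
  show "(\<lambda>x. norm (cnj (g x) * cnj (g x))) summable_on X"
    using assms(2) by (simp add: lp_space_def norm_mult power2_eq_square)
qed

lemma l2_inner_self: "l2_inner X f f = complex_of_real ((lp_norm 2 X f)\<^sup>2)"
proof -
  have eq: "f x * cnj (f x) = complex_of_real ((cmod (f x))\<^sup>2)" for x
    by (rule complex_norm_square[symmetric])
  have "(\<Sum>\<^sub>\<infinity>x\<in>X. complex_of_real ((cmod (f x))\<^sup>2)) = complex_of_real (\<Sum>\<^sub>\<infinity>x\<in>X. (cmod (f x))\<^sup>2)"
  proof (cases "(\<lambda>x. (cmod (f x))\<^sup>2) summable_on X")
    case True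
    then show ?thesis by (intro infsumI has_sum_of_real has_sum_infsum)
  next
    \<comment> \<open>Without summability both sides carry the default value 0 of
      \<open>infsum\<close>; real parts show that the complex sum diverges too.\<close>
    case False
    moreover have "\<not> (\<lambda>x. complex_of_real ((cmod (f x))\<^sup>2)) summable_on X"
    proof
      assume "(\<lambda>x. complex_of_real ((cmod (f x))\<^sup>2)) summable_on X"
      from summable_on_Re[OF this] False show False by simp
    qed
    ultimately show ?thesis by (simp add: infsum_not_exists)
  qed
  then show ?thesis
    unfolding l2_inner_def eq by (simp add: lp_norm_2 infsum_nonneg)
qed

abbreviation l2_add :: "('a \<Rightarrow> complex) \<Rightarrow> ('a \<Rightarrow> complex) \<Rightarrow> 'a \<Rightarrow> complex" where
  "l2_add f g \<equiv> (\<lambda>x. f x + g x)"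

abbreviation l2_scale :: "complex \<Rightarrow> ('a \<Rightarrow> complex) \<Rightarrow> 'a \<Rightarrow> complex" where
  "l2_scale a f \<equiv> (\<lambda>x. a * f x)"

lemma hilbert_norm_l2: "hilbert_norm (l2_inner X) f = lp_norm 2 X f"
  by (simp add: hilbert_norm_def l2_inner_self lp_norm_2_nonneg)

lemma hilbert_dist_l2:
  "hilbert_dist l2_add l2_scale (l2_inner X) f g = lp_norm 2 X (\<lambda>x. f x - g x)"
  by (simp add: hilbert_dist_def hilbert_norm_l2)

lemma lp_norm_2_zero_iff:
  assumes "f \<in> lp_space 2 X"
  shows "lp_norm 2 X f = 0 \<longleftrightarrow> f = (\<lambda>_. 0)"
proof
  assume 0: "lp_norm 2 X f = 0"
  show "f = (\<lambda>_. 0)"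
  proof
    fix x
    show "f x = 0"
      using finite_sum_le_lp_norm_2[OF assms, of "{x}"] 0 lp_space_2_offD[OF assms, of x]
      by (cases "x \<in> X") auto
  qed
qed (simp add: lp_norm_2)

section \<open>Completeness and the Hilbert space axioms\<close>

lemma Metric_space_l2:
  "Metric_space (lp_space 2 X) (hilbert_dist l2_add l2_scale (l2_inner X))"
proof
  fix f g h :: "'a \<Rightarrow> complex"
  \<comment> \<open>\<open>Metric_space\<close> asks for nonnegativity and symmetry on the whole
    type, so these precede the membership assumptions.\<close>
  show "0 \<le> hilbert_dist l2_add l2_scale (l2_inner X) f g"
    by (simp add: hilbert_dist_l2 lp_norm_2_nonneg)
  show "hilbert_dist l2_add l2_scale (l2_inner X) f g = hilbert_dist l2_add l2_scale (l2_inner X) g f"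
    by (simp add: hilbert_dist_l2 lp_norm_2 norm_minus_commute)
  assume f: "f \<in> lp_space 2 X" and g: "g \<in> lp_space 2 X"
  show "hilbert_dist l2_add l2_scale (l2_inner X) f g = 0 \<longleftrightarrow> f = g"
    by (simp add: hilbert_dist_l2 lp_norm_2_zero_iff lp_space_2_diff f g fun_eq_iff)
  assume h: "h \<in> lp_space 2 X"
  show "hilbert_dist l2_add l2_scale (l2_inner X) f h \<le>
    hilbert_dist l2_add l2_scale (l2_inner X) f g + hilbert_dist l2_add l2_scale (l2_inner X) g h"
    using lp_norm_2_triangle(2)[OF lp_space_2_diff[OF f g] lp_space_2_diff[OF g h]]
    by (simp add: hilbert_dist_l2)
qed

text \<open>Coordinates of a Cauchy sequence converge; norm convergence follows by letting one index
  tend to infinity in finite partial sums of the differences.\<close>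

lemma mcomplete_l2:
  "Metric_space.mcomplete (lp_space 2 X) (hilbert_dist l2_add l2_scale (l2_inner X))"
proof -
  interpret Metric_space "lp_space 2 X" "hilbert_dist l2_add l2_scale (l2_inner X)"
    by (rule Metric_space_l2)
  have "\<exists>g. limitin mtopology \<sigma> g sequentially" if "MCauchy \<sigma>" for \<sigma>
  proof -
    have \<sigma>: "\<sigma> n \<in> lp_space 2 X" for n
      using that by (auto simp: MCauchy_def)
    have cauchy: "\<exists>N. \<forall>n\<ge>N. \<forall>n'\<ge>N. lp_norm 2 X (\<lambda>x. \<sigma> n x - \<sigma> n' x) < e" if "e > 0" for e
    proof -
      have "\<forall>\<epsilon>>0. \<exists>N. \<forall>n n'. N \<le> n \<longrightarrow> N \<le> n' \<longrightarrow> lp_norm 2 X (\<lambda>x. \<sigma> n x - \<sigma> n' x) < \<epsilon>"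
        using \<open>MCauchy \<sigma>\<close> unfolding MCauchy_def hilbert_dist_l2 by (rule conjunct2)
      with that show ?thesis by blast
    qed
    define g where "g = (\<lambda>x. lim (\<lambda>n. \<sigma> n x))"
    have "convergent (\<lambda>n. \<sigma> n x)" for x
    proof -
      have le: "norm (\<sigma> n x - \<sigma> n' x) \<le> lp_norm 2 X (\<lambda>x. \<sigma> n x - \<sigma> n' x)" for n n'
      proof (cases "x \<in> X")
        case True
        then show ?thesis
          using finite_sum_le_lp_norm_2[OF lp_space_2_diff[OF \<sigma> \<sigma>], of "{x}" n n']
          by (simp add: power2_le_iff_abs_le lp_norm_2_nonneg)
      qed (simp add: lp_space_2_offD[OF \<sigma>] lp_norm_2_nonneg)
      have "Cauchy (\<lambda>n. \<sigma> n x)"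
      proof (rule metric_CauchyI)
        fix e :: real assume "e > 0"
        then obtain N where "\<forall>n\<ge>N. \<forall>n'\<ge>N. lp_norm 2 X (\<lambda>x. \<sigma> n x - \<sigma> n' x) < e"
          using cauchy by blast
        then show "\<exists>N. \<forall>n\<ge>N. \<forall>n'\<ge>N. dist (\<sigma> n x) (\<sigma> n' x) < e"
          unfolding dist_norm by (intro exI[of _ N] allI impI le_less_trans[OF le]) blast
      qed
      then show ?thesis by (rule Cauchy_convergent)
    qed
    then have lim: "(\<lambda>n. \<sigma> n x) \<longlonglongrightarrow> g x" for x
      by (simp add: g_def convergent_LIMSEQ_iff)
    have close: "\<exists>N. \<forall>n\<ge>N. (\<lambda>x. \<sigma> n x - g x) \<in> lp_space 2 X \<and> lp_norm 2 X (\<lambda>x. \<sigma> n x - g x) < e"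
      if "e > 0" for e
    proof -
      obtain N where N: "\<And>n n'. n \<ge> N \<Longrightarrow> n' \<ge> N \<Longrightarrow> lp_norm 2 X (\<lambda>x. \<sigma> n x - \<sigma> n' x) < e / 2"
        using cauchy[OF half_gt_zero[OF \<open>e > 0\<close>]] by blast
      show ?thesis
      proof (intro exI allI impI)
        fix n assume n: "n \<ge> N"
        \<comment> \<open>For fixed n the Cauchy estimate passes to the limit in n'; using e / 2
          restores the strict inequality afterwards.\<close>
        have bound: "(\<Sum>x\<in>F. (cmod (\<sigma> n x - g x))\<^sup>2) \<le> (e / 2)\<^sup>2" if F: "finite F" "F \<subseteq> X" for F
        proof (rule LIMSEQ_le_const2)
          show "(\<lambda>n'. \<Sum>x\<in>F. (cmod (\<sigma> n x - \<sigma> n' x))\<^sup>2) \<longlonglongrightarrow> (\<Sum>x\<in>F. (cmod (\<sigma> n x - g x))\<^sup>2)"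
            by (intro tendsto_intros lim)
          have "(\<Sum>x\<in>F. (cmod (\<sigma> n x - \<sigma> n' x))\<^sup>2) \<le> (e / 2)\<^sup>2" if "n' \<ge> N" for n'
          proof -
            have "(lp_norm 2 X (\<lambda>x. \<sigma> n x - \<sigma> n' x))\<^sup>2 \<le> (e / 2)\<^sup>2"
              using N[OF n that] by (intro power_mono) (auto simp: lp_norm_2_nonneg)
            then show ?thesis
              using finite_sum_le_lp_norm_2[OF lp_space_2_diff[OF \<sigma> \<sigma>] F, of n n'] by linarith
          qed
          then show "\<exists>N. \<forall>n'\<ge>N. (\<Sum>x\<in>F. (cmod (\<sigma> n x - \<sigma> n' x))\<^sup>2) \<le> (e / 2)\<^sup>2" by blast
        qed
        have off: "\<sigma> n x - g x = 0" if "x \<notin> X" for x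
          using lim[of x] lp_space_2_offD[OF \<sigma> that] by (simp add: LIMSEQ_const_iff)
        have "e / 2 \<ge> 0" using \<open>e > 0\<close> by simp
        note * = lp_space_2I[OF off bound this, of X]
        show "(\<lambda>x. \<sigma> n x - g x) \<in> lp_space 2 X \<and> lp_norm 2 X (\<lambda>x. \<sigma> n x - g x) < e"
          using * \<open>e > 0\<close> by simp
      qed
    qed
    \<comment> \<open>The limit g is the difference of the members \<open>\<sigma> n\<close> and
      \<open>\<sigma> n - g\<close>.\<close>
    obtain n where "(\<lambda>x. \<sigma> n x - g x) \<in> lp_space 2 X"
      using close[of 1] by auto
    from lp_space_2_diff[OF \<sigma>[of n] this] have "g \<in> lp_space 2 X" by simp
    then have "limitin mtopology \<sigma> g sequentially"
      unfolding limit_metric_sequentially hilbert_dist_l2 using \<sigma> close by blast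
    then show ?thesis by (rule exI[of _ g])
  qed
  then show ?thesis by (simp add: mcomplete_def)
qed

lemma complex_hilbert_space_l2:
  "complex_hilbert_space (lp_space 2 X) (\<lambda>_. 0) l2_add l2_scale (l2_inner X)"
proof
  show "Metric_space.mcomplete (lp_space 2 X) (hilbert_dist l2_add l2_scale (l2_inner X))"
    by (rule mcomplete_l2)
next
  fix f assume f: "f \<in> lp_space 2 X"
  show "\<exists>g\<in>lp_space 2 X. l2_add f g = (\<lambda>_. 0)"
    by (rule bexI[OF _ lp_space_2_cmult[OF f, of "-1"]]) simp
  show "l2_inner X f f \<in> \<real>\<^sub>\<ge>\<^sub>0"
    unfolding l2_inner_self by (subst nonneg_Reals_of_real_iff) simp
  show "f = (\<lambda>_. 0)" if "l2_inner X f f = 0"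
    using that lp_norm_2_zero_iff[OF f] by (simp add: l2_inner_self)
next
  fix f g h assume "f \<in> lp_space 2 X" "g \<in> lp_space 2 X" "h \<in> lp_space 2 X"
  then show "l2_inner X (l2_add f g) h = l2_inner X f h + l2_inner X g h"
    unfolding l2_inner_def by (simp add: distrib_right infsum_add l2_inner_summable)
next
  fix f g a assume "f \<in> lp_space 2 X" "g \<in> lp_space 2 X"
  then show "l2_inner X (l2_scale a f) g = a * l2_inner X f g"
    unfolding l2_inner_def by (simp add: mult.assoc infsum_cmult_right l2_inner_summable)
next
  fix f g
  show "l2_inner X g f = cnj (l2_inner X f g)"
    unfolding l2_inner_def by (simp flip: infsum_cnj add: mult.commute)
qed (auto simp: algebra_simps lp_norm_2_triangle(1) lp_space_2_cmult, simp add: lp_space_def)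

section \<open>Gram matrices in an abstract Hilbert space\<close>

text \<open>The vector is specified through its inner products alone, which spares an iterated sum
  over the explicit operations and suffices for Gram matrices.\<close>

lemma (in complex_hilbert_space) linear_combination:
  fixes n :: nat
  assumes "\<And>i. i < n \<Longrightarrow> \<eta> i \<in> H"
  shows "\<exists>v\<in>H. \<forall>w\<in>H. ip v w = (\<Sum>i<n. c i * ip (\<eta> i) w)"
  using assms
proof (induction n)
  case 0
  have "ip zero w = 0" if "w \<in> H" for w
    using ip_add[OF zero_closed zero_closed that] by (simp add: add_zero zero_closed)
  then show ?case using zero_closed by auto
next
  case (Suc n)
  have "\<exists>v\<in>H. \<forall>w\<in>H. ip v w = (\<Sum>i<n. c i * ip (\<eta> i) w)"
    by (rule Suc.IH) (rule Suc.prems, simp)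
  then obtain v where v: "v \<in> H" "\<forall>w\<in>H. ip v w = (\<Sum>i<n. c i * ip (\<eta> i) w)"
    by blast
  show ?case
    by (rule bexI[of _ "add v (smul (c n) (\<eta> n))"])
       (use v Suc.prems[of n] in \<open>auto simp: ip_add ip_scale scale_closed add_closed\<close>)
qed

text \<open>The double sum is the squared norm of the combination of the \<open>\<eta> i\<close>
  with coefficients \<open>c i\<close>.\<close>

lemma (in complex_hilbert_space) Gram_nonneg:
  fixes c :: "nat \<Rightarrow> real"
  assumes "\<And>i. i < n \<Longrightarrow> \<eta> i \<in> H"
  shows "(\<Sum>i<n. \<Sum>j<n. c i * c j * Re (ip (\<eta> i) (\<eta> j))) \<ge> 0"
proof -
  have "\<exists>v\<in>H. \<forall>w\<in>H. ip v w = (\<Sum>i<n. complex_of_real (c i) * ip (\<eta> i) w)"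
    by (rule linear_combination[OF assms])
  then obtain v where v: "v \<in> H" "\<And>w. w \<in> H \<Longrightarrow> ip v w = (\<Sum>i<n. complex_of_real (c i) * ip (\<eta> i) w)"
    by blast
  have "ip v v = (\<Sum>i<n. of_real (c i) * ip (\<eta> i) v)" by (rule v(2)[OF v(1)])
  also have "\<dots> = (\<Sum>i<n. of_real (c i) * cnj (ip v (\<eta> i)))"
    by (intro sum.cong refl arg_cong2[of _ _ _ _ "(*)"]) (rule ip_cnj[OF v(1) assms], simp)
  also have "\<dots> = (\<Sum>i<n. \<Sum>j<n. of_real (c i) * (of_real (c j) * cnj (ip (\<eta> j) (\<eta> i))))"
    by (intro sum.cong refl) (simp add: v(2) assms sum_distrib_left)
  also have "\<dots> = (\<Sum>i<n. \<Sum>j<n. of_real (c i * c j) * ip (\<eta> i) (\<eta> j))"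
    by (intro sum.cong refl) (simp add: ip_cnj[OF assms assms, symmetric] mult.assoc)
  finally have "Re (ip v v) = (\<Sum>i<n. \<Sum>j<n. c i * c j * Re (ip (\<eta> i) (\<eta> j)))"
    by simp
  then show ?thesis using ip_nonneg[OF v(1)] by (auto simp: complex_nonneg_Reals_iff)
qed

lemma (in complex_hilbert_space) hilbert_dist_square:
  assumes u: "u \<in> H" and v: "v \<in> H"
  shows "(hilbert_dist add smul ip u v)\<^sup>2 = Re (ip u u) + Re (ip v v) - 2 * Re (ip u v)"
proof -
  note mv = scale_closed[OF v, of "-1"]
  let ?w = "add u (smul (- 1) v)"
  have w: "?w \<in> H" using u mv by (rule add_closed)
  have left: "ip ?w z = ip u z - ip v z" if "z \<in> H" for z
    using ip_add[OF u mv that] ip_scale[OF v that, of "-1"] by simp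
  have "ip ?w ?w = cnj (ip ?w u) - cnj (ip ?w v)"
    using left[OF w] ip_cnj[OF w u] ip_cnj[OF w v] by simp
  then have "Re (ip ?w ?w) = Re (ip u u) - Re (ip v u) - (Re (ip u v) - Re (ip v v))"
    by (simp add: left u v)
  moreover have "Re (ip v u) = Re (ip u v)" using ip_cnj[OF u v] by simp
  moreover have "Re (ip ?w ?w) \<ge> 0"
    using ip_nonneg[OF w] by (auto simp: complex_nonneg_Reals_iff)
  ultimately show ?thesis by (simp add: hilbert_dist_def hilbert_norm_def)
qed

section \<open>Families of functions supported in balls\<close>

locale ulf_fuzzy_metric_space = fuzzy_metric_space X M T
  for X :: "'a set" and M :: "'a \<Rightarrow> 'a \<Rightarrow> real \<Rightarrow> real" and T :: "real \<Rightarrow> real \<Rightarrow> real" +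
  assumes nzd: "no_zero_divisors T"
    and ulf: "uniformly_locally_finite X M"
begin

lemma M_self: "x \<in> X \<Longrightarrow> t > 0 \<Longrightarrow> M x x t = 1"
  by (simp add: M_eq_1_iff)

lemma fball_self: "x \<in> X \<Longrightarrow> r > 0 \<Longrightarrow> t > 0 \<Longrightarrow> x \<in> fball X M x r t"
  by (simp add: fball_def M_self)

lemma fball_subset: "fball X M x r t \<subseteq> X"
  by (auto simp: fball_def)

lemma finite_fball: "r \<in> {0<..<1} \<Longrightarrow> t > 0 \<Longrightarrow> x \<in> X \<Longrightarrow> finite (fball X M x r t)"
  using ulf unfolding uniformly_locally_finite_def by blast

lemma card_fball_bound:
  assumes "r \<in> {0<..<1}" "t > 0"
  obtains N :: nat where "N > 0" "\<And>x. x \<in> X \<Longrightarrow> card (fball X M x r t) \<le> N"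
  using ulf assms unfolding uniformly_locally_finite_def by (meson less_imp_le)

text \<open>The triangle inequality and monotonicity bound M x z (t + u) below by m = T (1 - r) (1 -
  s), which is nonzero because T has no zero divisors. This is the substitute for adding
  distances.\<close>

lemma close_trans:
  assumes "r \<in> {0<..<1}" "s \<in> {0<..<1}" "t > 0" "u > 0"
  shows "\<exists>R\<in>{0<..<1}. \<forall>x\<in>X. \<forall>y\<in>X. \<forall>z\<in>X.
           M x y t > 1 - r \<longrightarrow> M y z u > 1 - s \<longrightarrow> M x z (t + u) > 1 - R"
proof -
  define m where "m = T (1 - r) (1 - s)"
  have m: "m \<in> {0..1}" "m \<noteq> 0"
    using T_closed[of "1 - r" "1 - s"] nzd assms by (auto simp: m_def no_zero_divisors_def)
  have "M x z (t + u) > 1 - (1 - m / 2)"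
    if "x \<in> X" "y \<in> X" "z \<in> X" "M x y t > 1 - r" "M y z u > 1 - s" for x y z
  proof -
    have "m \<le> T (M x y t) (M y z u)"
      unfolding m_def using that assms M_range[of x y t] M_range[of y z u]
      by (intro T_mono) auto
    also have "\<dots> \<le> M x z (t + u)"
      using that assms by (intro M_triangle) auto
    finally show ?thesis using m by auto
  qed
  \<comment> \<open>Halving m makes the comparison strict and keeps 1 - m / 2 inside (0, 1).\<close>
  then show ?thesis using m by (intro bexI[of _ "1 - m / 2"]) auto
qed

text \<open>One use of \<open>close_trans\<close> per edge turns a bound on path length into a ball
  whose parameters are independent of its centre.\<close>

lemma chain_subset_fball:
  assumes R: "R \<in> {0<..<1}" "U > 0"
    and E: "\<And>x y. E x y \<Longrightarrow> x \<in> X \<and> y \<in> fball X M x R U"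
  shows "\<exists>R'\<in>{0<..<1}. \<exists>U'>0. \<forall>x\<in>X. (\<Union>i\<le>n. {z. (E ^^ i) x z}) \<subseteq> fball X M x R' U'"
proof (induction n)
  case 0
  show ?case
    by (rule bexI[of _ R], rule exI[of _ U]) (use R fball_self in auto)
next
  case (Suc n)
  then obtain R' U' where R': "R' \<in> {0<..<1}" "U' > 0"
    and IH: "\<And>x z i. x \<in> X \<Longrightarrow> i \<le> n \<Longrightarrow> (E ^^ i) x z \<Longrightarrow> z \<in> fball X M x R' U'"
    by blast
  obtain Q where Q: "Q \<in> {0<..<1}" and step: "\<And>x y z. x \<in> X \<Longrightarrow> y \<in> X \<Longrightarrow> z \<in> X \<Longrightarrow>
      M x y U' > 1 - R' \<Longrightarrow> M y z U > 1 - R \<Longrightarrow> M x z (U' + U) > 1 - Q"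
    using close_trans[OF R'(1) R(1) R'(2) R(2)] by blast
  have "z \<in> fball X M x Q (U' + U)" if x: "x \<in> X" and i: "i \<le> Suc n" and z: "(E ^^ i) x z" for x z i
  proof (cases "i \<le> n")
    case True
    then have "z \<in> fball X M x R' U'" using IH x z by blast
    \<comment> \<open>A shorter path is padded by a trivial step from z to itself, to reach the
      larger scale.\<close>
    then show ?thesis
      using step[of x z z] x R by (auto simp: fball_def M_self)
  next
    case False
    with i have "i = Suc n" by simp
    with z obtain y where "(E ^^ n) x y" "E y z" by auto
    then show ?thesis
      using step[of x y z] x E[of y z] IH[of x n y] by (auto simp: fball_def)
  qed
  then show ?case
    using R R' Q by (intro bexI[of _ Q] exI[of _ "U' + U"]) auto
qed

end

section \<open>Reduction of the \<ell>^p conditions to finite sums of nonnegative reals\<close>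

lemma infsum_finite_support:
  assumes "finite F" "F \<subseteq> X" "\<And>z. z \<in> X - F \<Longrightarrow> f z = 0"
  shows "infsum f X = sum f F"
proof -
  have "infsum f X = infsum f F"
    by (rule infsum_cong_neutral) (use assms in auto)
  then show ?thesis using assms(1) by simp
qed

lemma summable_on_finite_support:
  assumes "finite F" "\<And>z. z \<in> X - F \<Longrightarrow> f z = 0"
  shows "f summable_on X"
  by (rule finite_nonzero_values_imp_summable_on, rule finite_subset[OF _ assms(1)])
     (use assms(2) in auto)

lemma lp_norm_finite_support:
  assumes "finite F" "F \<subseteq> X" "\<And>z. z \<in> X - F \<Longrightarrow> f z = 0" "p > 0"
  shows "lp_norm p X f = root p (\<Sum>z\<in>F. cmod (f z) ^ p)"
  unfolding lp_norm_def by (subst infsum_finite_support[OF assms(1,2)]) (use assms in auto)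

lemma lp_space_finite_support:
  assumes "finite F" "F \<subseteq> X" "\<And>z. z \<notin> F \<Longrightarrow> f z = 0" "p > 0"
  shows "f \<in> lp_space p X"
proof -
  have "(\<lambda>x. cmod (f x) ^ p) summable_on X"
    by (rule summable_on_finite_support[OF assms(1)]) (use assms in auto)
  then show ?thesis using assms by (auto simp: lp_space_def)
qed

text \<open>Members of \<open>lp_space\<close> vanish off X, so the support condition extends to all
  z of the type.\<close>

lemma lp_conditionE:
  assumes "lp_condition p X M" "\<epsilon> > 0" "r \<in> {0<..<1}" "t > 0"
  obtains \<eta> :: "'a \<Rightarrow> 'a \<Rightarrow> complex" and R U where
    "R \<in> {0<..<1}" "U > 0"
    "\<forall>x\<in>X. \<eta> x \<in> lp_space p X" "\<forall>x\<in>X. lp_norm p X (\<eta> x) = 1"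
    "\<forall>x\<in>X. \<forall>y\<in>X. M x y t > 1 - r \<longrightarrow> lp_norm p X (\<lambda>z. \<eta> x z - \<eta> y z) < \<epsilon>"
    "\<forall>x\<in>X. \<forall>z. z \<notin> fball X M x R U \<longrightarrow> \<eta> x z = 0"
proof -
  from assms(1)[unfolded lp_condition_def, rule_format, OF assms(2,3,4)]
  obtain \<eta> R U where R: "R \<in> {0<..<1}" "U > 0"
    and \<eta>: "\<forall>x\<in>X. \<eta> x \<in> lp_space p X" "\<forall>x\<in>X. lp_norm p X (\<eta> x) = 1"
    "\<forall>x\<in>X. \<forall>y\<in>X. M x y t > 1 - r \<longrightarrow> lp_norm p X (\<lambda>z. \<eta> x z - \<eta> y z) < \<epsilon>"
    and supp: "\<forall>x\<in>X. {z \<in> X. \<eta> x z \<noteq> 0} \<subseteq> fball X M x R U"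
    by (elim exE bexE conjE)
  have "\<forall>x\<in>X. \<forall>z. z \<notin> fball X M x R U \<longrightarrow> \<eta> x z = 0"
    using supp \<eta>(1) by (fastforce simp: lp_space_def)
  with R \<eta> show thesis by (rule that)
qed

text \<open>The radii of supports are called \<open>R\<close> and \<open>U\<close>, as \<open>T\<close> is the t-norm.\<close>

definition lp_family ::
    "nat \<Rightarrow> 'a set \<Rightarrow> ('a \<Rightarrow> 'a \<Rightarrow> real \<Rightarrow> real) \<Rightarrow> real \<Rightarrow> real \<Rightarrow> real \<Rightarrow>
      ('a \<Rightarrow> 'a \<Rightarrow> real) \<Rightarrow> real \<Rightarrow> real \<Rightarrow> bool" where
  "lp_family p X M \<epsilon> r t \<eta> R U \<longleftrightarrow> R \<in> {0<..<1} \<and> U > 0 \<and>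
     (\<forall>x\<in>X. \<forall>z. \<eta> x z \<ge> 0) \<and>
     (\<forall>x\<in>X. \<forall>z. z \<notin> fball X M x R U \<longrightarrow> \<eta> x z = 0) \<and>
     (\<forall>x\<in>X. (\<Sum>z\<in>fball X M x R U. \<eta> x z ^ p) = 1) \<and>
     (\<forall>x\<in>X. \<forall>y\<in>X. M x y t > 1 - r \<longrightarrow>
        (\<Sum>z\<in>fball X M x R U \<union> fball X M y R U. \<bar>\<eta> x z - \<eta> y z\<bar> ^ p) < \<epsilon>)"

lemma lp_familyD:
  assumes "lp_family p X M \<epsilon> r t \<eta> R U"
  shows "R \<in> {0<..<1}" "U > 0"
    "\<And>x z. x \<in> X \<Longrightarrow> \<eta> x z \<ge> 0"
    "\<And>x z. x \<in> X \<Longrightarrow> z \<notin> fball X M x R U \<Longrightarrow> \<eta> x z = 0"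
    "\<And>x. x \<in> X \<Longrightarrow> (\<Sum>z\<in>fball X M x R U. \<eta> x z ^ p) = 1"
    "\<And>x y. x \<in> X \<Longrightarrow> y \<in> X \<Longrightarrow> M x y t > 1 - r \<Longrightarrow>
        (\<Sum>z\<in>fball X M x R U \<union> fball X M y R U. \<bar>\<eta> x z - \<eta> y z\<bar> ^ p) < \<epsilon>"
  using assms unfolding lp_family_def by blast+

text \<open>Working form of \<open>lp_condition\<close>: here p-th powers of norms are compared with
  \<epsilon>, so the two conditions are related through roots and powers of \<epsilon>.\<close>

definition finite_lp_condition :: "nat \<Rightarrow> 'a set \<Rightarrow> ('a \<Rightarrow> 'a \<Rightarrow> real \<Rightarrow> real) \<Rightarrow> bool" where
  "finite_lp_condition p X M \<longleftrightarrow>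
     (\<forall>\<epsilon>>0. \<forall>r\<in>{0<..<1}. \<forall>t>0. \<exists>\<eta> R U. lp_family p X M \<epsilon> r t \<eta> R U)"

context ulf_fuzzy_metric_space
begin

text \<open>Pass to the moduli of the values: norms and supports are unchanged, and the reverse
  triangle inequality controls differences.\<close>

lemma lp_condition_imp_finite:
  assumes p: "p > 0" and lp: "lp_condition p X M"
  shows "finite_lp_condition p X M"
  unfolding finite_lp_condition_def
proof (intro allI ballI impI)
  fix \<epsilon> r t :: real assume \<epsilon>: "\<epsilon> > 0" and r: "r \<in> {0<..<1}" and t: "t > 0"
  then have "root p \<epsilon> > 0" using p by simp
  obtain \<eta> :: "'a \<Rightarrow> 'a \<Rightarrow> complex" and R U where R: "R \<in> {0<..<1}" "U > 0"
    and \<eta>: "\<forall>x\<in>X. \<eta> x \<in> lp_space p X" "\<forall>x\<in>X. lp_norm p X (\<eta> x) = 1"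
    "\<forall>x\<in>X. \<forall>y\<in>X. M x y t > 1 - r \<longrightarrow> lp_norm p X (\<lambda>z. \<eta> x z - \<eta> y z) < root p \<epsilon>"
    "\<forall>x\<in>X. \<forall>z. z \<notin> fball X M x R U \<longrightarrow> \<eta> x z = 0"
    by (rule lp_conditionE[OF lp \<open>root p \<epsilon> > 0\<close> r t])
  note norm = \<eta>(2)[rule_format] and close = \<eta>(3)[rule_format] and off = \<eta>(4)[rule_format]
  let ?B = "\<lambda>x. fball X M x R U"
  have "(\<Sum>z\<in>?B x. cmod (\<eta> x z) ^ p) = 1" if x: "x \<in> X" for x
    using norm[OF x] lp_norm_finite_support[OF finite_fball[OF R x] fball_subset, of "\<eta> x" p]
      off[OF x] p by simp
  moreover have "(\<Sum>z\<in>?B x \<union> ?B y. \<bar>cmod (\<eta> x z) - cmod (\<eta> y z)\<bar> ^ p) < \<epsilon>"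
    if xy: "x \<in> X" "y \<in> X" "M x y t > 1 - r" for x y
  proof -
    have "lp_norm p X (\<lambda>z. \<eta> x z - \<eta> y z) = root p (\<Sum>z\<in>?B x \<union> ?B y. cmod (\<eta> x z - \<eta> y z) ^ p)"
      by (rule lp_norm_finite_support)
         (use xy p off finite_fball[OF R] fball_subset in auto)
    with close[OF xy] p have "(\<Sum>z\<in>?B x \<union> ?B y. cmod (\<eta> x z - \<eta> y z) ^ p) < \<epsilon>"
      by simp
    moreover have "(\<Sum>z\<in>?B x \<union> ?B y. \<bar>cmod (\<eta> x z) - cmod (\<eta> y z)\<bar> ^ p) \<le>
      (\<Sum>z\<in>?B x \<union> ?B y. cmod (\<eta> x z - \<eta> y z) ^ p)"
      by (intro sum_mono power_mono norm_triangle_ineq3) auto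
    ultimately show ?thesis by linarith
  qed
  ultimately show "\<exists>\<eta> R U. lp_family p X M \<epsilon> r t \<eta> R U"
    using R off
    by (intro exI[of _ "\<lambda>x z. cmod (\<eta> x z)"] exI[of _ R] exI[of _ U]) (auto simp: lp_family_def)
qed

lemma finite_imp_lp_condition:
  assumes p: "p > 0" and lp: "finite_lp_condition p X M"
  shows "lp_condition p X M"
  unfolding lp_condition_def
proof (intro allI ballI impI)
  fix \<epsilon> r t :: real assume \<epsilon>: "\<epsilon> > 0" and r: "r \<in> {0<..<1}" and t: "t > 0"
  then have "\<epsilon> ^ p > 0" by simp
  obtain \<eta> R U where fam: "lp_family p X M (\<epsilon> ^ p) r t \<eta> R U"
    using lp[unfolded finite_lp_condition_def] \<open>\<epsilon> ^ p > 0\<close> r t by blast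
  note R = lp_familyD(1,2)[OF fam] and nn = lp_familyD(3)[OF fam] and off = lp_familyD(4)[OF fam]
    and norm = lp_familyD(5)[OF fam] and close = lp_familyD(6)[OF fam]
  let ?B = "\<lambda>x. fball X M x R U"
  let ?\<eta> = "\<lambda>x z. complex_of_real (\<eta> x z)"
  have "?\<eta> x \<in> lp_space p X" if x: "x \<in> X" for x
    by (rule lp_space_finite_support[OF finite_fball[OF R x] fball_subset]) (use off x p in auto)
  moreover have "lp_norm p X (?\<eta> x) = 1" if x: "x \<in> X" for x
    by (subst lp_norm_finite_support[OF finite_fball[OF R x] fball_subset])
       (use off nn norm x p in auto)
  moreover have "lp_norm p X (\<lambda>z. ?\<eta> x z - ?\<eta> y z) < \<epsilon>"
    if xy: "x \<in> X" "y \<in> X" "M x y t > 1 - r" for x y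
  proof -
    have "lp_norm p X (\<lambda>z. ?\<eta> x z - ?\<eta> y z) = root p (\<Sum>z\<in>?B x \<union> ?B y. cmod (?\<eta> x z - ?\<eta> y z) ^ p)"
      by (rule lp_norm_finite_support)
         (use xy p off finite_fball[OF R] fball_subset in auto)
    also have "\<dots> = root p (\<Sum>z\<in>?B x \<union> ?B y. \<bar>\<eta> x z - \<eta> y z\<bar> ^ p)"
      by (simp flip: of_real_diff)
    also have "\<dots> < root p (\<epsilon> ^ p)"
      using close[OF xy] p by simp
    also have "\<dots> = \<epsilon>" using p \<epsilon> by (simp add: real_root_power_cancel)
    finally show ?thesis .
  qed
  moreover have "{z \<in> X. ?\<eta> x z \<noteq> 0} \<subseteq> ?B x" if "x \<in> X" for x
    using off[OF that] by auto
  ultimately show "\<exists>\<eta> :: 'a \<Rightarrow> 'a \<Rightarrow> complex.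
          (\<forall>x\<in>X. \<eta> x \<in> lp_space p X) \<and>
          (\<forall>x\<in>X. lp_norm p X (\<eta> x) = 1) \<and>
          (\<forall>x\<in>X. \<forall>y\<in>X. M x y t > 1 - r \<longrightarrow> lp_norm p X (\<lambda>z. \<eta> x z - \<eta> y z) < \<epsilon>) \<and>
          (\<exists>R\<in>{0<..<1}. \<exists>T>0. \<forall>x\<in>X. {z \<in> X. \<eta> x z \<noteq> 0} \<subseteq> fball X M x R T)"
    using R by (intro exI[of _ ?\<eta>] conjI ballI bexI[of _ R] exI[of _ U] impI) auto
qed

lemma lp_condition_iff_finite: "p > 0 \<Longrightarrow> lp_condition p X M \<longleftrightarrow> finite_lp_condition p X M"
  using lp_condition_imp_finite finite_imp_lp_condition by blast

text \<open>Take square roots of the values; |sqrt a - sqrt b| \<le> sqrt a + sqrt b gives |sqrt a -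
  sqrt b|^2 \<le> |a - b|, so the same \<epsilon> works.\<close>

lemma finite_lp_condition_1_imp_2:
  assumes "finite_lp_condition 1 X M"
  shows "finite_lp_condition 2 X M"
  unfolding finite_lp_condition_def
proof (intro allI ballI impI)
  fix \<epsilon> r t :: real assume \<epsilon>: "\<epsilon> > 0" and r: "r \<in> {0<..<1}" and t: "t > 0"
  obtain \<eta> R U where fam: "lp_family 1 X M \<epsilon> r t \<eta> R U"
    using assms[unfolded finite_lp_condition_def] \<epsilon> r t by blast
  note R = lp_familyD(1,2)[OF fam] and nn = lp_familyD(3)[OF fam] and off = lp_familyD(4)[OF fam]
    and norm = lp_familyD(5)[OF fam] and close = lp_familyD(6)[OF fam]
  let ?B = "\<lambda>x. fball X M x R U"
  have sqrt_diff: "\<bar>sqrt a - sqrt b\<bar>\<^sup>2 \<le> \<bar>a - b\<bar>" if "a \<ge> 0" "b \<ge> 0" for a b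
  proof -
    have "\<bar>sqrt a - sqrt b\<bar>\<^sup>2 \<le> \<bar>sqrt a - sqrt b\<bar> * \<bar>sqrt a + sqrt b\<bar>"
      unfolding power2_eq_square using real_sqrt_ge_zero[OF that(1)] real_sqrt_ge_zero[OF that(2)]
      by (intro mult_left_mono) linarith+
    also have "\<dots> = \<bar>a - b\<bar>"
      unfolding abs_mult[symmetric] using that by (simp add: algebra_simps)
    finally show ?thesis .
  qed
  have "(\<Sum>z\<in>?B x \<union> ?B y. \<bar>sqrt (\<eta> x z) - sqrt (\<eta> y z)\<bar>\<^sup>2) < \<epsilon>"
    if xy: "x \<in> X" "y \<in> X" "M x y t > 1 - r" for x y
  proof -
    have "(\<Sum>z\<in>?B x \<union> ?B y. \<bar>sqrt (\<eta> x z) - sqrt (\<eta> y z)\<bar>\<^sup>2) \<le>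
      (\<Sum>z\<in>?B x \<union> ?B y. \<bar>\<eta> x z - \<eta> y z\<bar> ^ 1)"
      by (intro sum_mono) (use sqrt_diff nn xy in auto)
    with close[OF xy] show ?thesis by linarith
  qed
  then show "\<exists>\<eta> R U. lp_family 2 X M \<epsilon> r t \<eta> R U"
    using R off nn norm
    by (intro exI[of _ "\<lambda>x z. sqrt (\<eta> x z)"] exI[of _ R] exI[of _ U]) (auto simp: lp_family_def)
qed

text \<open>Take squares of the values: Cauchy-Schwarz on |a - b| |a + b| bounds the \<ell>^1
  difference by twice the \<ell>^2 difference of unit vectors, whence the tolerance (\<epsilon> /
  2)^2.\<close>

lemma finite_lp_condition_2_imp_1:
  assumes "finite_lp_condition 2 X M"
  shows "finite_lp_condition 1 X M"
  unfolding finite_lp_condition_def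
proof (intro allI ballI impI)
  fix \<epsilon> r t :: real assume \<epsilon>: "\<epsilon> > 0" and r: "r \<in> {0<..<1}" and t: "t > 0"
  then have \<epsilon>2: "(\<epsilon> / 2)\<^sup>2 > 0" by simp
  obtain \<eta> R U where fam: "lp_family 2 X M ((\<epsilon> / 2)\<^sup>2) r t \<eta> R U"
    using assms[unfolded finite_lp_condition_def] \<epsilon>2 r t by blast
  note R = lp_familyD(1,2)[OF fam] and nn = lp_familyD(3)[OF fam] and off = lp_familyD(4)[OF fam]
    and norm = lp_familyD(5)[OF fam] and close = lp_familyD(6)[OF fam]
  let ?B = "\<lambda>x. fball X M x R U"
  have "(\<Sum>z\<in>?B x \<union> ?B y. \<bar>(\<eta> x z)\<^sup>2 - (\<eta> y z)\<^sup>2\<bar>) < \<epsilon>"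
    if xy: "x \<in> X" "y \<in> X" "M x y t > 1 - r" for x y
  proof -
    let ?F = "?B x \<union> ?B y"
    have F: "finite ?F" using finite_fball[OF R] xy by simp
    have unit: "L2_set (\<eta> w) ?F = 1" if "w = x \<or> w = y" for w
    proof -
      have "(\<Sum>z\<in>?F. (\<eta> w z)\<^sup>2) = (\<Sum>z\<in>?B w. (\<eta> w z)\<^sup>2)"
        by (rule sum.mono_neutral_right[OF F]) (use that off xy in auto)
      then show ?thesis using norm[of w] that xy by (auto simp: L2_set_def)
    qed
    have "(\<Sum>z\<in>?F. \<bar>(\<eta> x z)\<^sup>2 - (\<eta> y z)\<^sup>2\<bar>) = (\<Sum>z\<in>?F. \<bar>\<eta> x z - \<eta> y z\<bar> * \<bar>\<eta> x z + \<eta> y z\<bar>)"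
      by (intro sum.cong refl) (simp flip: abs_mult add: power2_eq_square algebra_simps)
    also have "\<dots> \<le> L2_set (\<lambda>z. \<eta> x z - \<eta> y z) ?F * L2_set (\<lambda>z. \<eta> x z + \<eta> y z) ?F"
      by (rule L2_set_mult_ineq)
    also have "\<dots> \<le> L2_set (\<lambda>z. \<eta> x z - \<eta> y z) ?F * 2"
      using L2_set_triangle_ineq[of "\<eta> x" "\<eta> y" ?F] unit by (intro mult_left_mono) auto
    also have "L2_set (\<lambda>z. \<eta> x z - \<eta> y z) ?F < \<epsilon> / 2"
      unfolding L2_set_def using close[OF xy] \<epsilon> by (intro real_less_lsqrt) auto
    finally show ?thesis by simp
  qed
  then show "\<exists>\<eta> R U. lp_family 1 X M \<epsilon> r t \<eta> R U"
    using R off norm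
    by (intro exI[of _ "\<lambda>x z. (\<eta> x z)\<^sup>2"] exI[of _ R] exI[of _ U]) (auto simp: lp_family_def)
qed

end

section \<open>Property A and \<open>\<ell>\<^sup>1\<close>\<close>

lemma card_eq_sum_slices:
  assumes "finite F" "finite A" "A \<subseteq> F \<times> UNIV"
  shows "card A = (\<Sum>z\<in>F. card {n. (z, n) \<in> A})"
proof -
  let ?S = "\<lambda>z. {n. (z, n) \<in> A}"
  have "A = Sigma F ?S" using assms(3) by auto
  then have "card A = card (Sigma F ?S)" by (rule arg_cong)
  moreover have "finite {n. (z, n) \<in> A}" for z
    by (rule finite_subset[of _ "snd ` A"]) (use assms(2) in \<open>auto intro: rev_image_eqI\<close>)
  ultimately show ?thesis
    by (simp add: card_SigmaI[OF assms(1)])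
qed

lemma abs_card_diff_le:
  assumes "finite A" "finite B"
  shows "\<bar>real (card A) - real (card B)\<bar> \<le> real (card (sym_diff A B))"
proof -
  have "card A \<le> card (B \<union> sym_diff A B)" "card B \<le> card (A \<union> sym_diff A B)"
    by (rule card_mono; use assms in auto)+
  moreover note card_Un_le[of B "sym_diff A B"] card_Un_le[of A "sym_diff A B"]
  ultimately show ?thesis by linarith
qed

lemma card_inter_ge:
  assumes "finite A" "finite B"
  shows "real (card (A \<inter> B)) \<ge> real (card A) - real (card (sym_diff A B))"
proof -
  have "card A \<le> card ((A \<inter> B) \<union> sym_diff A B)"
    by (rule card_mono) (use assms in auto)
  also have "\<dots> \<le> card (A \<inter> B) + card (sym_diff A B)" by (rule card_Un_le)
  finally show ?thesis by linarith
qed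

text \<open>Write a / n - b / m = (a - b) / n + b (m - n) / (n m). Since b sums to m, each part
  contributes at most D / n.\<close>

lemma normalised_difference_sum:
  fixes a b :: "'a \<Rightarrow> real" and n m D :: real
  assumes "finite F" "n > 0" "m > 0" "\<And>z. z \<in> F \<Longrightarrow> b z \<ge> 0"
    and "(\<Sum>z\<in>F. b z) = m" "\<bar>n - m\<bar> \<le> D" "(\<Sum>z\<in>F. \<bar>a z - b z\<bar>) \<le> D"
  shows "(\<Sum>z\<in>F. \<bar>a z / n - b z / m\<bar>) \<le> 2 * D / n"
proof -
  have pt: "\<bar>a z / n - b z / m\<bar> \<le> \<bar>a z - b z\<bar> / n + b z * (\<bar>n - m\<bar> / (n * m))" if "z \<in> F" for z
  proof -
    have "a z / n - b z / m = (a z - b z) / n + b z * ((m - n) / (n * m))"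
      using assms(2,3) by (simp add: field_simps)
    also have "\<bar>\<dots>\<bar> \<le> \<bar>(a z - b z) / n\<bar> + \<bar>b z * ((m - n) / (n * m))\<bar>"
      by (rule abs_triangle_ineq)
    also have "\<dots> = \<bar>a z - b z\<bar> / n + b z * (\<bar>n - m\<bar> / (n * m))"
      using assms(2,3) assms(4)[OF that] by (simp add: abs_mult abs_minus_commute)
    finally show ?thesis .
  qed
  have "(\<Sum>z\<in>F. \<bar>a z / n - b z / m\<bar>) \<le> (\<Sum>z\<in>F. \<bar>a z - b z\<bar> / n + b z * (\<bar>n - m\<bar> / (n * m)))"
    by (rule sum_mono) (rule pt)
  also have "\<dots> = (\<Sum>z\<in>F. \<bar>a z - b z\<bar>) / n + (\<Sum>z\<in>F. b z) * (\<bar>n - m\<bar> / (n * m))"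
    by (simp add: sum.distrib sum_divide_distrib sum_distrib_right)
  also have "\<dots> = (\<Sum>z\<in>F. \<bar>a z - b z\<bar>) / n + \<bar>n - m\<bar> / n"
    using assms(2,3,5) by simp
  also have "\<dots> \<le> D / n + D / n"
    using assms by (intro add_mono divide_right_mono) auto
  finally show ?thesis by simp
qed

section \<open>From finite sets to probability vectors and back\<close>

context ulf_fuzzy_metric_space
begin

text \<open>The weight of z in the vector of x is the fraction of \<open>A x\<close> lying in the
  fibre over z. Normalisation doubles the error, so property A is used with \<epsilon> / 2.\<close>

lemma property_A_imp_finite_lp_1:
  assumes A: "property_A X M"
  shows "finite_lp_condition 1 X M"
  unfolding finite_lp_condition_def
proof (intro allI ballI impI)
  fix \<epsilon> r t :: real assume \<epsilon>: "\<epsilon> > 0" and r: "r \<in> {0<..<1}" and t: "t > 0"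
  from A[unfolded property_A_def, rule_format, OF half_gt_zero[OF \<epsilon>] t r]
  obtain U R and A :: "'a \<Rightarrow> ('a \<times> nat) set" where U: "U > 0" and R: "R \<in> {0<..<1}"
    and A: "\<forall>x\<in>X. finite (A x) \<and> A x \<noteq> {} \<and> A x \<subseteq> fball X M x R U \<times> UNIV"
    and small: "\<forall>x\<in>X. \<forall>y\<in>X. M x y t > 1 - r \<longrightarrow>
             real (card (sym_diff (A x) (A y))) < \<epsilon> / 2 * real (card (A x \<inter> A y))"
    by (elim exE bexE conjE)
  let ?B = "\<lambda>x. fball X M x R U"
  let ?s = "\<lambda>x z. {n. (z, n) \<in> A x}"
  define \<eta> where "\<eta> x z = real (card (?s x z)) / real (card (A x))" for x z
  have fin: "finite (A x)" and ne: "card (A x) > 0" and sub: "A x \<subseteq> ?B x \<times> UNIV" if "x \<in> X" for x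
    using A that by (auto simp: card_gt_0_iff)
  have fin_slice: "finite (?s x z)" if "x \<in> X" for x z
    by (rule finite_subset[of _ "snd ` A x"]) (use fin[OF that] in \<open>auto intro: rev_image_eqI\<close>)
  have mass: "(\<Sum>z\<in>F. real (card (?s x z))) = real (card (A x))"
    if "x \<in> X" "finite F" "?B x \<subseteq> F" for x F
    using card_eq_sum_slices[OF that(2) fin[OF that(1)]] sub[OF that(1)] that(3)
    by (simp add: subset_iff)
  have "\<eta> x z = 0" if "x \<in> X" "z \<notin> ?B x" for x z
  proof -
    have "?s x z = {}" using sub[OF that(1)] that(2) by auto
    then show ?thesis by (simp add: \<eta>_def)
  qed
  moreover have "(\<Sum>z\<in>?B x. \<eta> x z) = 1" if "x \<in> X" for x
    using mass[OF that finite_fball[OF R U that] order_refl] ne[OF that]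
    by (simp add: \<eta>_def flip: sum_divide_distrib)
  moreover have "(\<Sum>z\<in>?B x \<union> ?B y. \<bar>\<eta> x z - \<eta> y z\<bar>) < \<epsilon>"
    if xy: "x \<in> X" "y \<in> X" "M x y t > 1 - r" for x y
  proof -
    let ?F = "?B x \<union> ?B y" and ?D = "sym_diff (A x) (A y)"
    have F: "finite ?F" using finite_fball[OF R U] xy by simp
    have "(\<Sum>z\<in>?F. \<bar>\<eta> x z - \<eta> y z\<bar>) \<le> 2 * real (card ?D) / real (card (A x))"
      unfolding \<eta>_def
    proof (rule normalised_difference_sum[OF F])
      show "(\<Sum>z\<in>?F. real (card (?s y z))) = real (card (A y))"
        by (rule mass) (use xy F in auto)
      show "\<bar>real (card (A x)) - real (card (A y))\<bar> \<le> real (card ?D)"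
        by (intro abs_card_diff_le fin xy)
      have "(\<Sum>z\<in>?F. \<bar>real (card (?s x z)) - real (card (?s y z))\<bar>) \<le>
          (\<Sum>z\<in>?F. real (card (sym_diff (?s x z) (?s y z))))"
        by (intro sum_mono abs_card_diff_le fin_slice xy)
      \<comment> \<open>Taking fibres commutes with symmetric differences.\<close>
      also have "\<dots> = (\<Sum>z\<in>?F. real (card {n. (z, n) \<in> ?D}))"
        by (intro sum.cong refl arg_cong[of _ _ "\<lambda>S. real (card S)"]) auto
      also have "\<dots> = real (card ?D)"
        by (subst card_eq_sum_slices[OF F, of ?D]) (use fin xy sub[OF xy(1)] sub[OF xy(2)] in auto)
      finally show "(\<Sum>z\<in>?F. \<bar>real (card (?s x z)) - real (card (?s y z))\<bar>) \<le> real (card ?D)" .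
    qed (use ne xy in auto)
    also have "\<dots> < \<epsilon> * real (card (A x \<inter> A y)) / real (card (A x))"
      using small[rule_format, OF xy] ne[OF xy(1)] by (intro divide_strict_right_mono) auto
    also have "\<dots> \<le> \<epsilon> * real (card (A x)) / real (card (A x))"
      using \<epsilon> fin[OF xy(1)] by (intro divide_right_mono mult_left_mono) (auto intro: card_mono)
    also have "\<dots> = \<epsilon>" using ne[OF xy(1)] by simp
    finally show ?thesis .
  qed
  ultimately show "\<exists>\<eta> R U. lp_family 1 X M \<epsilon> r t \<eta> R U"
    using R U by (intro exI[of _ \<eta>] exI[of _ R] exI[of _ U]) (auto simp: lp_family_def \<eta>_def)
qed

text \<open>Scale the weights by a large L and round up: \<open>A x\<close> has a column of height
  \<open>k x z\<close> over each z of the ball. Its size is at least L, while symmetric differences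
  stay below a small multiple of L.\<close>

lemma finite_lp_1_imp_property_A:
  assumes lp: "finite_lp_condition 1 X M"
  shows "property_A X M"
  unfolding property_A_def
proof (intro allI ballI impI)
  fix \<epsilon> t r :: real assume \<epsilon>: "\<epsilon> > 0" and t: "t > 0" and r: "r \<in> {0<..<1}"
  \<comment> \<open>With this d one has 2 d (1 + \<epsilon>) = \<epsilon> / 2.\<close>
  define d where "d = \<epsilon> / (4 * (1 + \<epsilon>))"
  have d: "d > 0" using \<epsilon> by (simp add: d_def)
  have d_small: "2 * d * (1 + \<epsilon>) < \<epsilon>" using \<epsilon> by (simp add: d_def field_simps add_pos_pos)
  obtain \<eta> R U where fam: "lp_family 1 X M d r t \<eta> R U"
    using lp[unfolded finite_lp_condition_def] d r t by blast
  note R = lp_familyD(1,2)[OF fam] and nn = lp_familyD(3)[OF fam] and off = lp_familyD(4)[OF fam]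
    and norm = lp_familyD(5)[OF fam, simplified] and close = lp_familyD(6)[OF fam, simplified]
  let ?B = "\<lambda>x. fball X M x R U"
  obtain N where N: "N > 0" "\<And>x. x \<in> X \<Longrightarrow> card (?B x) \<le> N"
    using card_fball_bound[OF R] by blast
  \<comment> \<open>Rounding costs at most 1 at each of at most 2 N points; this L makes the total
    cost L d.\<close>
  define L where "L = 2 * real N / d"
  have L: "L > 0" using N d by (simp add: L_def)
  define k where "k x z = nat \<lceil>L * \<eta> x z\<rceil>" for x z
  define A where "A x = Sigma (?B x) (\<lambda>z. {..<k x z})" for x
  have k_lower: "L * \<eta> x z \<le> real (k x z)" for x z
    by (simp add: k_def real_nat_ceiling_ge)
  have k_diff: "\<bar>real (k x z) - real (k y z)\<bar> \<le> L * \<bar>\<eta> x z - \<eta> y z\<bar> + 1"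
    if "x \<in> X" "y \<in> X" for x y z
  proof -
    have "L * \<bar>\<eta> x z - \<eta> y z\<bar> = \<bar>L * \<eta> x z - L * \<eta> y z\<bar>"
      using L by (simp add: abs_mult flip: right_diff_distrib)
    moreover have "real (k w z) = of_int \<lceil>L * \<eta> w z\<rceil>" if "w \<in> X" for w
      using nn[OF that, of z] L by (simp add: k_def order_less_le_trans[of "-1" 0])
    ultimately show ?thesis
      using that by simp linarith
  qed
  have fin: "finite (A x)" if "x \<in> X" for x
    using finite_fball[OF R that] by (simp add: A_def)
  have card_A: "L \<le> real (card (A x))" if x: "x \<in> X" for x
  proof -
    have "L = (\<Sum>z\<in>?B x. L * \<eta> x z)" using norm[OF x] by (simp flip: sum_distrib_left)
    also have "\<dots> \<le> (\<Sum>z\<in>?B x. real (k x z))" by (intro sum_mono k_lower)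
    also have "\<dots> = real (card (A x))"
      unfolding A_def by (subst card_SigmaI) (use finite_fball[OF R x] in auto)
    finally show ?thesis .
  qed
  have diff: "real (card (sym_diff (A x) (A y))) \<le> 2 * L * d"
    if xy: "x \<in> X" "y \<in> X" "M x y t > 1 - r" for x y
  proof -
    let ?F = "?B x \<union> ?B y"
    have F: "finite ?F" using finite_fball[OF R] xy by simp
    have k0: "k w z = 0" if "w \<in> X" "z \<notin> ?B w" for w z
      using off[OF that] by (simp add: k_def)
    \<comment> \<open>Columns have height 0 outside their own ball, so both sets may be sliced over
      the union of the balls.\<close>
    have "sym_diff (A x) (A y) = Sigma ?F (\<lambda>z. sym_diff {..<k x z} {..<k y z})"
      using k0 xy by (auto simp: A_def intro: ccontr)
    then have "real (card (sym_diff (A x) (A y))) = (\<Sum>z\<in>?F. real (card (sym_diff {..<k x z} {..<k y z})))"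
      by (simp only:) (subst card_SigmaI[OF F]; simp)
    also have "\<dots> = (\<Sum>z\<in>?F. \<bar>real (k x z) - real (k y z)\<bar>)"
    proof (intro sum.cong refl)
      fix z
      \<comment> \<open>Columns are nested initial segments, so they differ by exactly the
        difference of their heights.\<close>
      have "sym_diff {..<a} {..<b} = {min a b..<max a b}" for a b :: nat by auto
      then show "real (card (sym_diff {..<k x z} {..<k y z})) = \<bar>real (k x z) - real (k y z)\<bar>"
        by (simp add: min_def max_def of_nat_diff)
    qed
    also have "\<dots> \<le> (\<Sum>z\<in>?F. L * \<bar>\<eta> x z - \<eta> y z\<bar> + 1)"
      by (intro sum_mono k_diff xy)
    also have "\<dots> = L * (\<Sum>z\<in>?F. \<bar>\<eta> x z - \<eta> y z\<bar>) + real (card ?F)"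
      by (simp add: sum.distrib sum_distrib_left)
    also have "\<dots> \<le> L * d + 2 * real N"
    proof (intro add_mono mult_left_mono)
      show "real (card ?F) \<le> 2 * real N"
        using card_Un_le[of "?B x" "?B y"] N(2)[OF xy(1)] N(2)[OF xy(2)] by linarith
    qed (use close[OF xy] L in auto)
    also have "\<dots> = 2 * L * d" using d by (simp add: L_def)
    finally show ?thesis .
  qed
  have "real (card (sym_diff (A x) (A y))) < \<epsilon> * real (card (A x \<inter> A y))"
    if xy: "x \<in> X" "y \<in> X" "M x y t > 1 - r" for x y
  proof -
    \<comment> \<open>Rearranged, this compares 2 L d with \<epsilon> times L - 2 L d, a lower bound
      for the intersection.\<close>
    have "2 * d * (1 + \<epsilon>) * L < \<epsilon> * L"
      using d_small L by (rule mult_strict_right_mono)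
    then have "2 * L * d < \<epsilon> * (L - 2 * L * d)" by (simp add: algebra_simps)
    also have "\<dots> \<le> \<epsilon> * real (card (A x \<inter> A y))"
      using card_inter_ge[OF fin[OF xy(1)] fin[OF xy(2)]] card_A[OF xy(1)] diff[OF xy] \<epsilon>
      by (intro mult_left_mono) linarith+
    finally show ?thesis using diff[OF xy] by linarith
  qed
  moreover have "A x \<noteq> {}" if "x \<in> X" for x
    using card_A[OF that] L by auto
  moreover have "A x \<subseteq> ?B x \<times> UNIV" for x by (auto simp: A_def)
  ultimately show "\<exists>t'>0. \<exists>r'\<in>{0<..<1}. \<exists>A :: 'a \<Rightarrow> ('a \<times> nat) set.
          (\<forall>x\<in>X. finite (A x) \<and> A x \<noteq> {} \<and> A x \<subseteq> fball X M x r' t' \<times> UNIV) \<and>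
          (\<forall>x\<in>X. \<forall>y\<in>X. M x y t > 1 - r \<longrightarrow>
             real (card (sym_diff (A x) (A y))) < \<epsilon> * real (card (A x \<inter> A y)))"
    using R fin by (intro exI[of _ U] conjI bexI[of _ R] exI[of _ A]) auto
qed

end

section \<open>Kernels and the uniform Roe algebra\<close>

lemma pos_def_kernel_real_finite:
  assumes k: "pos_def_kernel_real X k" and F: "finite F" "F \<subseteq> X"
  shows "(\<Sum>x\<in>F. \<Sum>y\<in>F. c x * c y * k x y) \<ge> 0"
proof -
  obtain h where h: "bij_betw h {..<card F} F"
    using ex_bij_betw_nat_finite[OF F(1)] by (auto simp: atLeast0LessThan)
  have "(\<Sum>x\<in>F. \<Sum>y\<in>F. c x * c y * k x y) =
    (\<Sum>i<card F. \<Sum>j<card F. c (h i) * c (h j) * k (h i) (h j))"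
    by (simp add: sum.reindex_bij_betw[OF h, symmetric])
  also have "\<dots> \<ge> 0"
  proof -
    have "\<forall>i<card F. h i \<in> X" using bij_betwE[OF h] F(2) by auto
    then show ?thesis
      using k[unfolded pos_def_kernel_real_def, rule_format, of "card F" h "\<lambda>i. c (h i)"] by simp
  qed
  finally show ?thesis .
qed

text \<open>Test positivity on the pair x, y with coefficients 1 and s = 1 or s = -1. This bounds a
  kernel by its diagonal.\<close>

lemma pos_def_kernel_real_bound:
  assumes k: "pos_def_kernel_real X k" and sym: "k x y = k y x" and "x \<in> X" "y \<in> X"
  shows "2 * \<bar>k x y\<bar> \<le> k x x + k y y"
proof -
  let ?p = "\<lambda>i::nat. if i = 0 then x else y"
  have p: "\<forall>i<2. ?p i \<in> X" using assms(3,4) by simp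
  have "0 \<le> k x x + k y y + 2 * s * k x y" if "s = 1 \<or> s = - 1" for s
    using k[unfolded pos_def_kernel_real_def, THEN spec, THEN spec, THEN spec, THEN mp, OF p,
        of "\<lambda>i. if i = 0 then 1 else s"] that sym
    by (auto simp: numeral_2_eq_2)
  from this[of 1] this[of "- 1"] show ?thesis by simp
qed

text \<open>Positivity over real coefficients does not force symmetry. The quadratic form sees only
  the symmetric part, so averaging with the transpose leaves it unchanged.\<close>

lemma pos_def_kernel_real_symmetrize:
  assumes "pos_def_kernel_real X k"
  shows "pos_def_kernel_real X (\<lambda>x y. (k x y + k y x) / 2)"
  unfolding pos_def_kernel_real_def
proof (intro allI impI)
  fix n :: nat and x :: "nat \<Rightarrow> 'a" and c :: "nat \<Rightarrow> real"
  assume x: "\<forall>i<n. x i \<in> X"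
  have "0 \<le> (\<Sum>i<n. \<Sum>j<n. c i * c j * k (x i) (x j))"
    using assms x unfolding pos_def_kernel_real_def by blast
  moreover have "(\<Sum>i<n. \<Sum>j<n. c i * c j * k (x j) (x i)) = (\<Sum>i<n. \<Sum>j<n. c i * c j * k (x i) (x j))"
    by (subst sum.swap) (simp add: mult.commute)
  moreover have "(\<Sum>i<n. \<Sum>j<n. c i * c j * ((k (x i) (x j) + k (x j) (x i)) / 2)) =
    ((\<Sum>i<n. \<Sum>j<n. c i * c j * k (x i) (x j)) + (\<Sum>i<n. \<Sum>j<n. c i * c j * k (x j) (x i))) / 2"
    by (simp add: sum.distrib sum_divide_distrib distrib_left add_divide_distrib)
  ultimately show "0 \<le> (\<Sum>i<n. \<Sum>j<n. c i * c j * ((k (x i) (x j) + k (x j) (x i)) / 2))"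
    by simp
qed

text \<open>Split the coefficients into real and imaginary parts: the real part of the form is a sum
  of two real forms, and the imaginary part cancels by symmetry.\<close>

lemma pos_def_kernel_complex_of_real:
  assumes k: "pos_def_kernel_real X k" and sym: "\<And>x y. k x y = k y x"
  shows "pos_def_kernel_complex X (\<lambda>x y. complex_of_real (k x y))"
  unfolding pos_def_kernel_complex_def
proof (intro allI impI)
  fix n :: nat and x :: "nat \<Rightarrow> 'a" and c :: "nat \<Rightarrow> complex"
  assume x: "\<forall>i<n. x i \<in> X"
  let ?S = "\<Sum>i<n. \<Sum>j<n. c i * cnj (c j) * complex_of_real (k (x i) (x j))"
  have pos: "0 \<le> (\<Sum>i<n. \<Sum>j<n. a i * a j * k (x i) (x j))" for a
    using k x unfolding pos_def_kernel_real_def by blast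
  have "Re ?S = (\<Sum>i<n. \<Sum>j<n. (Re (c i) * Re (c j) + Im (c i) * Im (c j)) * k (x i) (x j))"
    by simp
  then have "Re ?S = (\<Sum>i<n. \<Sum>j<n. Re (c i) * Re (c j) * k (x i) (x j)) +
                (\<Sum>i<n. \<Sum>j<n. Im (c i) * Im (c j) * k (x i) (x j))"
    by (simp only: distrib_right sum.distrib)
  moreover
  have "Im ?S = (\<Sum>i<n. \<Sum>j<n. (Im (c i) * Re (c j) - Re (c i) * Im (c j)) * k (x i) (x j))"
    by simp
  then have "Im ?S = (\<Sum>i<n. \<Sum>j<n. Im (c i) * Re (c j) * k (x i) (x j)) -
                (\<Sum>i<n. \<Sum>j<n. Re (c i) * Im (c j) * k (x i) (x j))"
    by (simp only: left_diff_distrib sum_subtractf)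
  moreover have "(\<Sum>i<n. \<Sum>j<n. Im (c i) * Re (c j) * k (x i) (x j)) =
      (\<Sum>i<n. \<Sum>j<n. Re (c i) * Im (c j) * k (x i) (x j))"
    by (subst sum.swap) (simp only: sym mult.commute)
  ultimately show "?S \<in> \<real>\<^sub>\<ge>\<^sub>0"
    using pos[of "\<lambda>i. Re (c i)"] pos[of "\<lambda>i. Im (c i)"]
    by (simp only: complex_nonneg_Reals_iff) simp
qed

lemma pos_def_kernel_real_Re:
  assumes k: "pos_def_kernel_complex X k"
  shows "pos_def_kernel_real X (\<lambda>x y. Re (k x y))"
  unfolding pos_def_kernel_real_def
proof (intro allI impI)
  fix n :: nat and x :: "nat \<Rightarrow> 'a" and c :: "nat \<Rightarrow> real"
  assume x: "\<forall>i<n. x i \<in> X"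
  let ?c = "\<lambda>i. complex_of_real (c i)"
  have "(\<Sum>i<n. \<Sum>j<n. ?c i * cnj (?c j) * k (x i) (x j)) \<in> \<real>\<^sub>\<ge>\<^sub>0"
    using k[unfolded pos_def_kernel_complex_def, THEN spec, THEN spec, THEN spec, THEN mp, OF x] .
  then have "0 \<le> Re (\<Sum>i<n. \<Sum>j<n. ?c i * cnj (?c j) * k (x i) (x j))"
    by (simp only: complex_nonneg_Reals_iff)
  also have "\<dots> = (\<Sum>i<n. \<Sum>j<n. c i * c j * Re (k (x i) (x j)))"
    by simp
  finally show "0 \<le> (\<Sum>i<n. \<Sum>j<n. c i * c j * Re (k (x i) (x j)))" .
qed

section \<open>Real kernels from complex kernels and from Hilbert space maps\<close>

lemma roe_imp_real_kernel:
  assumes "roe_kernel_condition X M"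
  shows "real_kernel_condition X M"
  unfolding real_kernel_condition_def
proof (intro allI ballI impI)
  fix \<epsilon> r t :: real assume "\<epsilon> > 0" "r \<in> {0<..<1}" "t > 0"
  from assms[unfolded roe_kernel_condition_def, rule_format, OF this]
  obtain R U and k :: "'a \<Rightarrow> 'a \<Rightarrow> complex" where R: "R \<in> {0<..<1}" "U > 0"
    and k: "pos_def_kernel_complex X k"
    and close: "\<forall>x\<in>X. \<forall>y\<in>X. M x y t > 1 - r \<longrightarrow> cmod (1 - k x y) < \<epsilon>"
    and far: "\<forall>x\<in>X. \<forall>y\<in>X. M x y U < 1 - R \<longrightarrow> k x y = 0"
    by (elim exE bexE conjE)
  have "\<bar>1 - Re (k x y)\<bar> < \<epsilon>" if "x \<in> X" "y \<in> X" "M x y t > 1 - r" for x y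
    using close[rule_format, OF that] abs_Re_le_cmod[of "1 - k x y"] by simp
  then show "\<exists>R\<in>{0<..<1}. \<exists>T>0. \<exists>k :: 'a \<Rightarrow> 'a \<Rightarrow> real.
          pos_def_kernel_real X k \<and>
          (\<forall>x\<in>X. \<forall>y\<in>X. M x y t > 1 - r \<longrightarrow> \<bar>1 - k x y\<bar> < \<epsilon>) \<and>
          (\<forall>x\<in>X. \<forall>y\<in>X. M x y T < 1 - R \<longrightarrow> k x y = 0)"
    using R far pos_def_kernel_real_Re[OF k]
    by (intro bexI[of _ R] exI[of _ U] conjI exI[of _ "\<lambda>x y. Re (k x y)"]) auto
qed

text \<open>The kernel is the real part of the inner product. For unit vectors 1 - k is half the
  squared distance, so distances below \<open>sqrt \<epsilon>\<close> suffice.\<close>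

lemma hilbert_imp_real_kernel:
  assumes "hilbert_condition TYPE('h) X M"
  shows "real_kernel_condition X M"
  unfolding real_kernel_condition_def
proof (intro allI ballI impI)
  fix \<epsilon> r t :: real assume \<epsilon>: "\<epsilon> > 0" and rt: "r \<in> {0<..<1}" "t > 0"
  have "sqrt \<epsilon> > 0" using \<epsilon> by simp
  from assms[unfolded hilbert_condition_def, rule_format, OF this rt]
  obtain H :: "'h set" and zero add smul ip \<eta> R U
    where H: "complex_hilbert_space H zero add smul ip"
    and \<eta>: "\<forall>x\<in>X. \<eta> x \<in> H" and unit: "\<forall>x\<in>X. hilbert_norm ip (\<eta> x) = 1"
    and close: "\<forall>x\<in>X. \<forall>y\<in>X. M x y t > 1 - r \<longrightarrow> hilbert_dist add smul ip (\<eta> x) (\<eta> y) < sqrt \<epsilon>"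
    and R: "R \<in> {0<..<1}" "U > 0"
    and far: "\<forall>x\<in>X. \<forall>y\<in>X. M x y U < 1 - R \<longrightarrow> ip (\<eta> x) (\<eta> y) = 0"
    by (elim exE bexE conjE)
  interpret complex_hilbert_space H zero add smul ip by (rule H)
  define k where "k x y = Re (ip (\<eta> x) (\<eta> y))" for x y
  have "pos_def_kernel_real X k"
    unfolding pos_def_kernel_real_def k_def using \<eta> by (intro allI impI Gram_nonneg) auto
  moreover have "\<bar>1 - k x y\<bar> < \<epsilon>" if xy: "x \<in> X" "y \<in> X" "M x y t > 1 - r" for x y
  proof -
    let ?d = "hilbert_dist add smul ip (\<eta> x) (\<eta> y)"
    have one: "Re (ip (\<eta> w) (\<eta> w)) = 1" if "w \<in> X" for w
      using unit that by (simp add: hilbert_norm_def)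
    have "?d\<^sup>2 = 2 - 2 * k x y"
      using hilbert_dist_square[of "\<eta> x" "\<eta> y"] \<eta> xy one by (simp add: k_def)
    moreover have "?d\<^sup>2 < (sqrt \<epsilon>)\<^sup>2"
    proof (rule power_strict_mono)
      have "Re (ip w w) \<ge> 0" if "w \<in> H" for w
        using ip_nonneg[OF that] by (simp add: complex_nonneg_Reals_iff)
      then show "0 \<le> ?d"
        using \<eta> xy by (simp add: hilbert_dist_def hilbert_norm_def add_closed scale_closed)
    qed (use close xy in auto)
    moreover have "(sqrt \<epsilon>)\<^sup>2 = \<epsilon>" using \<epsilon> by simp
    moreover have "?d\<^sup>2 \<ge> 0" by simp
    ultimately show ?thesis using \<epsilon> by linarith
  qed
  moreover have "\<forall>x\<in>X. \<forall>y\<in>X. M x y U < 1 - R \<longrightarrow> k x y = 0"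
    using far by (simp add: k_def)
  ultimately show "\<exists>R\<in>{0<..<1}. \<exists>T>0. \<exists>k :: 'a \<Rightarrow> 'a \<Rightarrow> real.
          pos_def_kernel_real X k \<and>
          (\<forall>x\<in>X. \<forall>y\<in>X. M x y t > 1 - r \<longrightarrow> \<bar>1 - k x y\<bar> < \<epsilon>) \<and>
          (\<forall>x\<in>X. \<forall>y\<in>X. M x y T < 1 - R \<longrightarrow> k x y = 0)"
    using R by (intro bexI[of _ R] exI[of _ U] conjI exI[of _ k]) auto
qed

text \<open>Cauchy-Schwarz against the constant function B on F.\<close>

lemma abs_sum_mult_le_card:
  fixes f :: "'a \<Rightarrow> complex"
  assumes B: "\<And>y. y \<in> F \<Longrightarrow> cmod (g y) \<le> B" "B \<ge> 0" and N: "card F \<le> N"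
  shows "(cmod (\<Sum>y\<in>F. g y * f y))\<^sup>2 \<le> N * B\<^sup>2 * (\<Sum>y\<in>F. (cmod (f y))\<^sup>2)"
proof -
  have "cmod (\<Sum>y\<in>F. g y * f y) \<le> (\<Sum>y\<in>F. B * cmod (f y))"
    by (rule order_trans[OF norm_sum sum_mono]) (use B in \<open>auto simp: norm_mult intro: mult_right_mono\<close>)
  then have "(cmod (\<Sum>y\<in>F. g y * f y))\<^sup>2 \<le> (\<Sum>y\<in>F. B * cmod (f y))\<^sup>2"
    by (intro power_mono) auto
  also have "\<dots> \<le> (\<Sum>y\<in>F. B\<^sup>2) * (\<Sum>y\<in>F. (cmod (f y))\<^sup>2)"
    by (rule Cauchy_Schwarz_ineq_sum)
  also have "\<dots> \<le> N * B\<^sup>2 * (\<Sum>y\<in>F. (cmod (f y))\<^sup>2)"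
    using N by (intro mult_right_mono) (auto intro: sum_nonneg mult_right_mono)
  finally show ?thesis .
qed

section \<open>Band kernels: factorisation into local vectors and action on \<ell>^2(X)\<close>

context ulf_fuzzy_metric_space
begin

text \<open>Take \<ell>^2(X) itself as Hilbert space. A common support point of two vectors forces
  their indices to be close at scale U + U, so far apart vectors are orthogonal.\<close>

lemma lp_2_imp_hilbert:
  assumes lp: "lp_condition 2 X M"
  shows "hilbert_condition TYPE('a \<Rightarrow> complex) X M"
  unfolding hilbert_condition_def
proof (intro allI ballI impI)
  fix \<epsilon> r t :: real assume \<epsilon>: "\<epsilon> > 0" and r: "r \<in> {0<..<1}" and t: "t > 0"
  obtain \<eta> :: "'a \<Rightarrow> 'a \<Rightarrow> complex" and R U where R: "R \<in> {0<..<1}" "U > 0"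
    and \<eta>: "\<forall>x\<in>X. \<eta> x \<in> lp_space 2 X" "\<forall>x\<in>X. lp_norm 2 X (\<eta> x) = 1"
    "\<forall>x\<in>X. \<forall>y\<in>X. M x y t > 1 - r \<longrightarrow> lp_norm 2 X (\<lambda>z. \<eta> x z - \<eta> y z) < \<epsilon>"
    and off: "\<forall>x\<in>X. \<forall>z. z \<notin> fball X M x R U \<longrightarrow> \<eta> x z = 0"
    by (rule lp_conditionE[OF lp \<epsilon> r t])
  obtain Q where Q: "Q \<in> {0<..<1}" and step: "\<And>x y z. x \<in> X \<Longrightarrow> y \<in> X \<Longrightarrow> z \<in> X \<Longrightarrow>
      M x y U > 1 - R \<Longrightarrow> M y z U > 1 - R \<Longrightarrow> M x z (U + U) > 1 - Q"
    using close_trans[OF R(1) R(1) R(2) R(2)] by blast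
  have "l2_inner X (\<eta> x) (\<eta> y) = 0" if xy: "x \<in> X" "y \<in> X" "M x y (U + U) < 1 - Q" for x y
  proof -
    have "\<eta> x z * cnj (\<eta> y z) = 0" if "z \<in> X" for z
    proof (rule ccontr)
      assume "\<eta> x z * cnj (\<eta> y z) \<noteq> 0"
      then have "z \<in> fball X M x R U" "z \<in> fball X M y R U" using off xy by auto
      then have "M x y (U + U) > 1 - Q"
        using step[of x z y] xy R M_sym[of z y U] by (auto simp: fball_def)
      with xy show False by simp
    qed
    then show ?thesis unfolding l2_inner_def by (rule infsum_0)
  qed
  then have far: "\<exists>R\<in>{0<..<1}. \<exists>T>0. \<forall>x\<in>X. \<forall>y\<in>X. M x y T < 1 - R \<longrightarrow> l2_inner X (\<eta> x) (\<eta> y) = 0"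
    using Q R by (intro bexI[of _ Q] exI[of _ "U + U"]) auto
  have "\<exists>\<eta>. (\<forall>x\<in>X. \<eta> x \<in> lp_space 2 X) \<and>
          (\<forall>x\<in>X. hilbert_norm (l2_inner X) (\<eta> x) = 1) \<and>
          (\<forall>x\<in>X. \<forall>y\<in>X. M x y t > 1 - r \<longrightarrow> hilbert_dist l2_add l2_scale (l2_inner X) (\<eta> x) (\<eta> y) < \<epsilon>) \<and>
          (\<exists>R\<in>{0<..<1}. \<exists>T>0. \<forall>x\<in>X. \<forall>y\<in>X. M x y T < 1 - R \<longrightarrow> l2_inner X (\<eta> x) (\<eta> y) = 0)"
    unfolding hilbert_norm_l2 hilbert_dist_l2 using \<eta> far by (intro exI[of _ \<eta>] conjI)
  then show "\<exists>(H :: ('a \<Rightarrow> complex) set) zero add smul ip. complex_hilbert_space H zero add smul ip \<and>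
        (\<exists>\<eta> :: 'a \<Rightarrow> 'a \<Rightarrow> complex.
          (\<forall>x\<in>X. \<eta> x \<in> H) \<and>
          (\<forall>x\<in>X. hilbert_norm ip (\<eta> x) = 1) \<and>
          (\<forall>x\<in>X. \<forall>y\<in>X. M x y t > 1 - r \<longrightarrow> hilbert_dist add smul ip (\<eta> x) (\<eta> y) < \<epsilon>) \<and>
          (\<exists>R\<in>{0<..<1}. \<exists>T>0. \<forall>x\<in>X. \<forall>y\<in>X. M x y T < 1 - R \<longrightarrow> ip (\<eta> x) (\<eta> y) = 0))"
    by (intro exI[of _ "lp_space 2 X"] exI[of _ "\<lambda>_. 0"] exI[of _ l2_add] exI[of _ l2_scale]
        exI[of _ "l2_inner X"] conjI[OF complex_hilbert_space_l2])
qed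

text \<open>Normal form for later use: symmetrise and extend by zero. Since M x x t = 1, the
  diagonal lies in the region where the kernel is close to 1, and it bounds all other
  entries.\<close>

lemma real_kernelE:
  assumes rk: "real_kernel_condition X M" and \<epsilon>: "\<epsilon> > 0" and r: "r \<in> {0<..<1}" and t: "t > 0"
  obtains k :: "'a \<Rightarrow> 'a \<Rightarrow> real" and R U where "R \<in> {0<..<1}" "U > 0"
    "pos_def_kernel_real X k"
    "\<forall>x y. k x y = k y x"
    "\<forall>x y. k x y \<noteq> 0 \<longrightarrow> x \<in> X \<and> y \<in> fball X M x R U"
    "\<forall>x y. \<bar>k x y\<bar> \<le> 1 + \<epsilon>"
    "\<forall>x\<in>X. \<forall>y\<in>X. M x y t > 1 - r \<longrightarrow> \<bar>1 - k x y\<bar> < \<epsilon>"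
proof -
  from rk[unfolded real_kernel_condition_def, rule_format, OF \<epsilon> r t]
  obtain R U k where R: "R \<in> {0<..<1}" "U > 0" and k: "pos_def_kernel_real X k"
    and close: "\<forall>x\<in>X. \<forall>y\<in>X. M x y t > 1 - r \<longrightarrow> \<bar>1 - k x y\<bar> < \<epsilon>"
    and far: "\<forall>x\<in>X. \<forall>y\<in>X. M x y U < 1 - R \<longrightarrow> k x y = 0"
    by (elim exE bexE conjE)
  define K where "K x y = (if x \<in> X \<and> y \<in> X then (k x y + k y x) / 2 else 0)" for x y
  have pd: "pos_def_kernel_real X K"
    using pos_def_kernel_real_symmetrize[OF k] unfolding pos_def_kernel_real_def K_def by simp
  have sym: "K x y = K y x" for x y by (simp add: K_def)
  have close_K: "\<bar>1 - K x y\<bar> < \<epsilon>" if "x \<in> X" "y \<in> X" "M x y t > 1 - r" for x y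
  proof -
    have "\<bar>1 - k x y\<bar> < \<epsilon>" "\<bar>1 - k y x\<bar> < \<epsilon>"
      using close that M_sym[of x y t] t by auto
    then show ?thesis using that by (simp add: K_def abs_if field_simps split: if_splits)
  qed
  have bound: "\<bar>K x y\<bar> \<le> 1 + \<epsilon>" for x y
  proof (cases "x \<in> X \<and> y \<in> X")
    case True
    have diag: "K w w \<le> 1 + \<epsilon>" if "w \<in> X" for w
      using close_K[of w w] M_self[of w t] that r t by auto
    from True have "K x x \<le> 1 + \<epsilon>" "K y y \<le> 1 + \<epsilon>" "2 * \<bar>K x y\<bar> \<le> K x x + K y y"
      using diag pos_def_kernel_real_bound[OF pd sym] by auto
    then show ?thesis by linarith
  next
    case False
    then show ?thesis using \<epsilon> by (auto simp: K_def)
  qed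
  \<comment> \<open>A nonzero entry gives only M x y U \<ge> 1 - R; enlarging R to (1 + R) / 2 gives
    the strict inequality of a ball.\<close>
  have supp: "x \<in> X \<and> y \<in> fball X M x ((1 + R) / 2) U" if "K x y \<noteq> 0" for x y
  proof -
    have xy: "x \<in> X" "y \<in> X" "k x y \<noteq> 0 \<or> k y x \<noteq> 0"
      using that by (auto simp: K_def split: if_splits)
    then have "M x y U \<ge> 1 - R"
      using far M_sym[of x y U] R by (metis not_le)
    with xy R show ?thesis by (auto simp: fball_def field_simps)
  qed
  show thesis
    by (rule that[of "(1 + R) / 2" U K]) (use R pd sym close_K bound supp in \<open>simp_all add: field_simps\<close>)
qed

text \<open>The approximate square root supplies locally supported vectors whose inner products are
  close to K. Normalising them and taking absolute values gives the required unit family.\<close>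

lemma real_kernel_imp_finite_lp_2:
  assumes rk: "real_kernel_condition X M"
  shows "finite_lp_condition 2 X M"
  unfolding finite_lp_condition_def
proof (intro allI ballI impI)
  fix \<epsilon> r t :: real assume \<epsilon>: "\<epsilon> > 0" and r: "r \<in> {0<..<1}" and t: "t > 0"
  \<comment> \<open>Error budget: the final bound is 8 d, which must be below \<epsilon>, and 1 - 4
    d must be nonnegative.\<close>
  define d where "d = min \<epsilon> 1 / 16"
  have d: "d > 0" "16 * d \<le> \<epsilon>" "16 * d \<le> 1" using \<epsilon> by (auto simp: d_def)
  obtain K :: "'a \<Rightarrow> 'a \<Rightarrow> real" and R U where R: "R \<in> {0<..<1}" "U > 0"
    and pd: "pos_def_kernel_real X K"
    and K: "\<forall>x y. K x y = K y x"
    "\<forall>x y. K x y \<noteq> 0 \<longrightarrow> x \<in> X \<and> y \<in> fball X M x R U"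
    "\<forall>x y. \<bar>K x y\<bar> \<le> 1 + d"
    "\<forall>x\<in>X. \<forall>y\<in>X. M x y t > 1 - r \<longrightarrow> \<bar>1 - K x y\<bar> < d"
    by (rule real_kernelE[OF rk d(1) r t])
  obtain N where N: "N > 0" "\<And>x. x \<in> X \<Longrightarrow> card (fball X M x R U) \<le> N"
    using card_fball_bound[OF R] by blast
  have row: "finite {y. K x y \<noteq> 0} \<and> card {y. K x y \<noteq> 0} \<le> N" for x
  proof (cases "x \<in> X")
    case True
    have "{y. K x y \<noteq> 0} \<subseteq> fball X M x R U" using K(2) by auto
    then show ?thesis
      using finite_fball[OF R True] N(2)[OF True] by (meson card_mono finite_subset order_trans)
  next
    case False
    then have "{y. K x y \<noteq> 0} = {}" using K(2) by auto
    then show ?thesis by simp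
  qed
  interpret psd_band_kernel K N "1 + d"
  proof
    fix F :: "'a set" and f :: "'a \<Rightarrow> real" assume F: "finite F"
    have K0: "K x y = 0" if "x \<notin> X \<or> y \<notin> X" for x y
      using K(1,2) that by (metis (no_types))
    \<comment> \<open>Points outside X contribute nothing, so positivity on X extends to the whole
      type.\<close>
    have "(\<Sum>x\<in>F. \<Sum>y\<in>F. f x * f y * K x y) = (\<Sum>x\<in>F. \<Sum>y\<in>F \<inter> X. f x * f y * K x y)"
      by (intro sum.cong refl sum.mono_neutral_right F) (use K0 in auto)
    also have "\<dots> = (\<Sum>x\<in>F \<inter> X. \<Sum>y\<in>F \<inter> X. f x * f y * K x y)"
      by (intro sum.mono_neutral_right F) (use K0 in \<open>auto intro!: sum.neutral\<close>)
    also have "\<dots> \<ge> 0" using F by (intro pos_def_kernel_real_finite[OF pd]) auto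
    finally show "0 \<le> (\<Sum>x\<in>F. \<Sum>y\<in>F. f x * f y * K x y)" .
  qed (use K(1,3) row in auto)
  from approximate_square_root[OF d(1)]
  obtain n \<zeta> where \<zeta>_supp: "\<forall>x. finite (fsupp (\<zeta> x)) \<and>
             fsupp (\<zeta> x) \<subseteq> (\<Union>i\<le>n. {z. ((\<lambda>x y. K x y \<noteq> 0) ^^ i) x z})"
    and \<zeta>: "\<forall>x y. \<bar>fip (\<zeta> x) (\<zeta> y) - K x y\<bar> < d"
    by (elim exE conjE)
  obtain Q V where Q: "Q \<in> {0<..<1}" "V > 0"
    and chain: "\<forall>x\<in>X. (\<Union>i\<le>n. {z. ((\<lambda>x y. K x y \<noteq> 0) ^^ i) x z}) \<subseteq> fball X M x Q V"
    using chain_subset_fball[OF R, of "\<lambda>x y. K x y \<noteq> 0" n] K(2) by blast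
  let ?B = "\<lambda>x. fball X M x Q V"
  have supp: "fsupp (\<zeta> x) \<subseteq> ?B x" if "x \<in> X" for x
    using \<zeta>_supp chain that by blast
  define a where "a x = sqrt (fip (\<zeta> x) (\<zeta> x))" for x
  have near: "\<bar>fip (\<zeta> x) (\<zeta> y) - 1\<bar> < 2 * d" if "x \<in> X" "y \<in> X" "M x y t > 1 - r" for x y
  proof -
    have "\<bar>1 - K x y\<bar> < d" using K(4) that by blast
    moreover have "\<bar>fip (\<zeta> x) (\<zeta> y) - K x y\<bar> < d" using \<zeta> by blast
    ultimately show ?thesis by linarith
  qed
  have self: "\<bar>fip (\<zeta> x) (\<zeta> x) - 1\<bar> < 2 * d" if "x \<in> X" for x
    using near[of x x] M_self[of x t] that r t by simp
  have a_sq: "(a x)\<^sup>2 = fip (\<zeta> x) (\<zeta> x)" and a_pos: "a x > 0" if "x \<in> X" for x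
  proof -
    have "fip (\<zeta> x) (\<zeta> x) > 0" using self[OF that] d by linarith
    then show "(a x)\<^sup>2 = fip (\<zeta> x) (\<zeta> x)" "a x > 0" by (auto simp: a_def)
  qed
  \<comment> \<open>Absolute values secure nonnegativity and, by the reverse triangle inequality, do
    not increase differences.\<close>
  define \<eta> where "\<eta> x z = \<bar>\<zeta> x z\<bar> / a x" for x z
  have "\<eta> x z = 0" if "x \<in> X" "z \<notin> ?B x" for x z
    using supp[OF that(1)] that(2) by (auto simp: \<eta>_def fsupp_def)
  moreover have "(\<Sum>z\<in>?B x. (\<eta> x z)\<^sup>2) = 1" if x: "x \<in> X" for x
  proof -
    have "(\<Sum>z\<in>?B x. (\<eta> x z)\<^sup>2) = (\<Sum>z\<in>?B x. \<zeta> x z * \<zeta> x z) / (a x)\<^sup>2"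
      by (simp add: \<eta>_def power_divide power2_eq_square sum_divide_distrib)
    also have "(\<Sum>z\<in>?B x. \<zeta> x z * \<zeta> x z) = fip (\<zeta> x) (\<zeta> x)"
      by (rule fip_eq_sum[OF finite_fball[OF Q x] supp[OF x], symmetric])
    finally show ?thesis unfolding a_sq[OF x, symmetric] using a_pos[OF x] by simp
  qed
  moreover have "(\<Sum>z\<in>?B x \<union> ?B y. \<bar>\<eta> x z - \<eta> y z\<bar>\<^sup>2) < \<epsilon>"
    if xy: "x \<in> X" "y \<in> X" "M x y t > 1 - r" for x y
  proof -
    let ?F = "?B x \<union> ?B y"
    have F: "finite ?F" using finite_fball[OF Q] xy by simp
    have fip_F: "(\<Sum>z\<in>?F. \<zeta> u z * \<zeta> v z) = fip (\<zeta> u) (\<zeta> v)" if "u = x \<or> u = y" for u v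
      by (rule fip_eq_sum[OF F, symmetric]) (use supp xy that in blast)
    have pt: "\<bar>\<eta> x z - \<eta> y z\<bar>\<^sup>2 \<le> \<zeta> x z * \<zeta> x z / (a x)\<^sup>2 + \<zeta> y z * \<zeta> y z / (a y)\<^sup>2
       - 2 * (\<zeta> x z * \<zeta> y z) / (a x * a y)" for z
    proof -
      have eq: "\<eta> w z = \<bar>\<zeta> w z / a w\<bar>" if "w \<in> X" for w
        using a_pos[OF that] by (simp add: \<eta>_def)
      have "\<bar>\<eta> x z - \<eta> y z\<bar> \<le> \<bar>\<zeta> x z / a x - \<zeta> y z / a y\<bar>"
        unfolding eq[OF xy(1)] eq[OF xy(2)] by (rule abs_triangle_ineq3)
      then have "\<bar>\<eta> x z - \<eta> y z\<bar>\<^sup>2 \<le> \<bar>\<zeta> x z / a x - \<zeta> y z / a y\<bar>\<^sup>2"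
        by (intro power_mono) auto
      also have "\<dots> = \<zeta> x z * \<zeta> x z / (a x)\<^sup>2 + \<zeta> y z * \<zeta> y z / (a y)\<^sup>2
       - 2 * (\<zeta> x z * \<zeta> y z) / (a x * a y)"
        by (simp add: power2_eq_square algebra_simps)
      finally show ?thesis .
    qed
    have "(\<Sum>z\<in>?F. \<bar>\<eta> x z - \<eta> y z\<bar>\<^sup>2) \<le> (\<Sum>z\<in>?F. \<zeta> x z * \<zeta> x z / (a x)\<^sup>2 + \<zeta> y z * \<zeta> y z / (a y)\<^sup>2
       - 2 * (\<zeta> x z * \<zeta> y z) / (a x * a y))"
      by (intro sum_mono pt)
    also have "\<dots> = fip (\<zeta> x) (\<zeta> x) / (a x)\<^sup>2 + fip (\<zeta> y) (\<zeta> y) / (a y)\<^sup>2 - 2 * fip (\<zeta> x) (\<zeta> y) / (a x * a y)"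
      by (simp add: sum.distrib sum_subtractf fip_F flip: sum_divide_distrib sum_distrib_left)
    also have "\<dots> = 2 - 2 * (fip (\<zeta> x) (\<zeta> y) / (a x * a y))"
      using a_pos[OF xy(1)] a_pos[OF xy(2)] by (simp flip: a_sq[OF xy(1)] a_sq[OF xy(2)])
    also have "\<dots> \<le> 8 * d"
    proof -
      \<comment> \<open>The normalised inner product is at least (1 - 2 d) / (1 + 2 d), hence at
        least 1 - 4 d.\<close>
      have "2 * (a x * a y) \<le> (a x)\<^sup>2 + (a y)\<^sup>2"
        using sum_squares_bound[of "a x" "a y"] by simp
      then have "a x * a y \<le> 1 + 2 * d"
        using self[OF xy(1)] self[OF xy(2)] unfolding a_sq[OF xy(1)] a_sq[OF xy(2)] by linarith
      then have "(1 - 4 * d) * (a x * a y) \<le> (1 - 4 * d) * (1 + 2 * d)"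
        using d by (intro mult_left_mono) auto
      also have "\<dots> \<le> 1 - 2 * d"
        by (simp add: algebra_simps)
      also have "\<dots> \<le> fip (\<zeta> x) (\<zeta> y)" using near[OF xy] by linarith
      finally have "1 - 4 * d \<le> fip (\<zeta> x) (\<zeta> y) / (a x * a y)"
        using a_pos[OF xy(1)] a_pos[OF xy(2)] by (simp add: pos_le_divide_eq)
      then show ?thesis by linarith
    qed
    also have "\<dots> < \<epsilon>" using d by linarith
    finally show ?thesis .
  qed
  moreover have "\<eta> x z \<ge> 0" if "x \<in> X" for x z
    using a_pos[OF that] by (simp add: \<eta>_def)
  ultimately show "\<exists>\<eta> R U. lp_family 2 X M \<epsilon> r t \<eta> R U"
    using Q by (intro exI[of _ \<eta>] exI[of _ Q] exI[of _ V]) (auto simp: lp_family_def)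
qed

text \<open>Cauchy-Schwarz along rows, then counting along columns, bounds the operator by N B. It
  has finite propagation itself, so it serves as its own approximant in the norm closure.\<close>

lemma band_operator_roe:
  fixes k :: "'a \<Rightarrow> 'a \<Rightarrow> complex"
  assumes R: "R \<in> {0<..<1}" "U > 0"
    and supp: "\<And>x y. k x y \<noteq> 0 \<Longrightarrow> x \<in> X \<and> y \<in> fball X M x R U"
    and B: "\<And>x y. cmod (k x y) \<le> B"
  shows "(\<lambda>y. k x y * f y) summable_on X"
    and "l2_bounded_operator X (kernel_operator X k)"
    and "kernel_operator X k \<in> uniform_roe_algebra X M"
proof -
  let ?B = "\<lambda>x. fball X M x R U" and ?S = "kernel_operator X k"
  obtain N where N: "N > 0" "\<And>x. x \<in> X \<Longrightarrow> card (?B x) \<le> N"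
    using card_fball_bound[OF R] by blast
  have B0: "B \<ge> 0" using B[of undefined undefined] norm_ge_zero order_trans by blast
  have off: "k x y = 0" if "y \<notin> ?B x" for x y using supp that by blast
  show "(\<lambda>y. k x y * f y) summable_on X" for x f
  proof (cases "x \<in> X")
    case True
    show ?thesis
      by (rule summable_on_finite_support[OF finite_fball[OF R True]]) (use off in auto)
  next
    case False
    then have "(\<lambda>y. k x y * f y) = (\<lambda>_. 0)" using supp by (metis mult_zero_left)
    then show ?thesis by simp
  qed
  have S: "?S f x = (\<Sum>y\<in>?B x. k x y * f y)" if "x \<in> X" for f x
    unfolding kernel_operator_def
    by (simp add: that) (rule infsum_finite_support[OF finite_fball[OF R that] fball_subset]; simp add: off)
  have S_off: "?S f x = 0" if "x \<notin> X" for f x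
    using that by (simp add: kernel_operator_def)
  have bound: "(\<Sum>x\<in>F. (cmod (?S f x))\<^sup>2) \<le> (N * B * lp_norm 2 X f)\<^sup>2"
    if f: "f \<in> lp_space 2 X" and F: "finite F" "F \<subseteq> X" for f F
  proof -
    let ?G = "\<Union>x\<in>F. ?B x" and ?q = "\<lambda>y. (cmod (f y))\<^sup>2"
    have fin: "finite (?B x)" if "x \<in> F" for x using finite_fball[OF R] F that by blast
    have G: "finite ?G" "?G \<subseteq> X" using F fin by (auto simp: fball_def)
    have outer: "(\<Sum>x\<in>F. (cmod (?S f x))\<^sup>2) \<le> (\<Sum>x\<in>F. N * B\<^sup>2 * (\<Sum>y\<in>?B x. ?q y))"
    proof (rule sum_mono)
      fix x assume "x \<in> F"
      then have "x \<in> X" using F by blast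
      then show "(cmod (?S f x))\<^sup>2 \<le> N * B\<^sup>2 * (\<Sum>y\<in>?B x. ?q y)"
        unfolding S[OF \<open>x \<in> X\<close>] by (intro abs_sum_mult_le_card B B0 N)
    qed
    \<comment> \<open>Indicator terms over a common set ?G allow the summations to be
      exchanged.\<close>
    have "(\<Sum>x\<in>F. \<Sum>y\<in>?B x. ?q y) = (\<Sum>x\<in>F. \<Sum>y\<in>?G. if y \<in> ?B x then ?q y else 0)"
    proof (rule sum.cong[OF refl])
      fix x assume "x \<in> F"
      then have "?G \<inter> ?B x = ?B x" by blast
      then show "(\<Sum>y\<in>?B x. ?q y) = (\<Sum>y\<in>?G. if y \<in> ?B x then ?q y else 0)"
        using G(1) by (simp flip: sum.inter_restrict)
    qed
    also have "\<dots> = (\<Sum>y\<in>?G. \<Sum>x\<in>F. if y \<in> ?B x then ?q y else 0)"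
      by (rule sum.swap)
    also have "\<dots> \<le> (\<Sum>y\<in>?G. N * ?q y)"
    proof (rule sum_mono)
      fix y assume "y \<in> ?G"
      then have y: "y \<in> X" using G by blast
      \<comment> \<open>Symmetry of M places all centres whose ball contains y in the ball around
        y.\<close>
      have "{x \<in> F. y \<in> ?B x} \<subseteq> ?B y"
        using F(2) M_sym[OF _ y R(2)] y by (auto simp: fball_def subset_iff)
      then have "card {x \<in> F. y \<in> ?B x} \<le> N"
        using card_mono[OF finite_fball[OF R y]] N(2)[OF y] order_trans by blast
      moreover have "(\<Sum>x\<in>F. if y \<in> ?B x then ?q y else 0) = card {x \<in> F. y \<in> ?B x} * ?q y"
        using F(1) by (simp flip: sum.inter_filter)
      ultimately show "(\<Sum>x\<in>F. if y \<in> ?B x then ?q y else 0) \<le> N * ?q y"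
        by (simp add: mult_right_mono)
    qed
    also have "\<dots> \<le> N * (lp_norm 2 X f)\<^sup>2"
      using finite_sum_le_lp_norm_2[OF f G] by (simp flip: sum_distrib_left add: mult_left_mono)
    finally have "N * B\<^sup>2 * (\<Sum>x\<in>F. \<Sum>y\<in>?B x. ?q y) \<le> N * B\<^sup>2 * (N * (lp_norm 2 X f)\<^sup>2)"
      by (rule mult_left_mono) simp
    with outer show ?thesis
      by (simp add: sum_distrib_left[symmetric] power2_eq_square mult_ac)
  qed
  have nn: "N * B * lp_norm 2 X f \<ge> 0" for f
    using B0 by (simp add: lp_norm_2_nonneg)
  have "?S f \<in> lp_space 2 X" "lp_norm 2 X (?S f) \<le> (N * B) * lp_norm 2 X f"
    if f: "f \<in> lp_space 2 X" for f
    using lp_space_2I[OF S_off bound[OF f] nn] by auto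
  moreover have "?S (\<lambda>x. f x + g x) = (\<lambda>x. ?S f x + ?S g x)" for f g
  proof
    fix x show "?S (\<lambda>x. f x + g x) x = ?S f x + ?S g x"
      by (cases "x \<in> X") (simp_all add: S S_off distrib_left sum.distrib)
  qed
  moreover have "?S (\<lambda>x. a * f x) = (\<lambda>x. a * ?S f x)" for f a
  proof
    fix x show "?S (\<lambda>x. a * f x) x = a * ?S f x"
      by (cases "x \<in> X") (simp_all add: S S_off sum_distrib_left mult_ac)
  qed
  ultimately show bdd: "l2_bounded_operator X ?S"
    unfolding l2_bounded_operator_def by blast
  have "l2_inner X (?S (delta y)) (delta x) = k x y" if "x \<in> X" for x y
  proof -
    have "l2_inner X (?S (delta y)) (delta x) = (\<Sum>z\<in>{x}. ?S (delta y) z * cnj (delta x z))"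
      unfolding l2_inner_def by (rule infsum_finite_support) (use that in \<open>auto simp: delta_def\<close>)
    also have "\<dots> = (\<Sum>z\<in>?B x. k x z * delta y z)"
      by (simp add: delta_def[of x] S[OF that])
    also have "\<dots> = k x y"
      using off[of y x] finite_fball[OF R that] by (simp add: delta_def sum.If_cases if_distrib cong: if_cong)
    finally show ?thesis .
  qed
  moreover have "k x y = 0" if "M x y U < 1 - R" for x y
    using that by (intro off) (auto simp: fball_def)
  ultimately have band: "finite_propagation X M ?S"
    unfolding finite_propagation_def using R by (intro exI[of _ U] conjI bexI[of _ R]) auto
  have "l2_onorm X (\<lambda>f x. ?S f x - ?S f x) = 0"
  proof -
    \<comment> \<open>The zero function makes the unit ball nonempty, so the supremum of the
      constant 0 is 0.\<close>
    have "(\<lambda>_. 0) \<in> {f \<in> lp_space 2 X. lp_norm 2 X f \<le> 1}"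
      by (simp add: lp_space_def lp_norm_2)
    then have "{f \<in> lp_space 2 X. lp_norm 2 X f \<le> 1} \<noteq> {}" by blast
    then show ?thesis by (simp add: l2_onorm_def lp_norm_2)
  qed
  then show "?S \<in> uniform_roe_algebra X M"
    unfolding uniform_roe_algebra_def using bdd band by (auto intro!: exI[of _ ?S])
qed

text \<open>In the normal form of \<open>real_kernelE\<close> the kernel is symmetric, hence
  positive definite over the complex numbers, and its bounded entries and band support give
  membership in the Roe algebra.\<close>

lemma real_kernel_imp_roe:
  assumes rk: "real_kernel_condition X M"
  shows "roe_kernel_condition X M"
  unfolding roe_kernel_condition_def
proof (intro allI ballI impI)
  fix \<epsilon> r t :: real assume \<epsilon>: "\<epsilon> > 0" and r: "r \<in> {0<..<1}" and t: "t > 0"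
  obtain K :: "'a \<Rightarrow> 'a \<Rightarrow> real" and R U where R: "R \<in> {0<..<1}" "U > 0"
    and pd: "pos_def_kernel_real X K"
    and K: "\<forall>x y. K x y = K y x"
    "\<forall>x y. K x y \<noteq> 0 \<longrightarrow> x \<in> X \<and> y \<in> fball X M x R U"
    "\<forall>x y. \<bar>K x y\<bar> \<le> 1 + \<epsilon>"
    "\<forall>x\<in>X. \<forall>y\<in>X. M x y t > 1 - r \<longrightarrow> \<bar>1 - K x y\<bar> < \<epsilon>"
    by (rule real_kernelE[OF rk \<epsilon> r t])
  let ?k = "\<lambda>x y. complex_of_real (K x y)"
  note op = band_operator_roe[OF R, of ?k "1 + \<epsilon>"]
  have "cmod (1 - ?k x y) < \<epsilon>" if "x \<in> X" "y \<in> X" "M x y t > 1 - r" for x y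
  proof -
    have "cmod (1 - ?k x y) = \<bar>1 - K x y\<bar>"
      by (metis norm_of_real of_real_1 of_real_diff real_norm_def)
    then show ?thesis using K(4) that by simp
  qed
  moreover have "?k x y = 0" if "M x y U < 1 - R" for x y
    using K(2) that by (fastforce simp: fball_def)
  moreover have "pos_def_kernel_complex X ?k"
    using pos_def_kernel_complex_of_real[OF pd] K(1) by blast
  moreover have "(\<lambda>y. ?k x y * f y) summable_on X" for x f
    by (rule op(1)) (use K in auto)
  moreover have "l2_bounded_operator X (kernel_operator X ?k)"
    by (rule op(2)) (use K in auto)
  moreover have "kernel_operator X ?k \<in> uniform_roe_algebra X M"
    by (rule op(3)) (use K in auto)
  ultimately show "\<exists>R\<in>{0<..<1}. \<exists>T>0. \<exists>k :: 'a \<Rightarrow> 'a \<Rightarrow> complex.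
          pos_def_kernel_complex X k \<and>
          (\<forall>x\<in>X. \<forall>y\<in>X. M x y t > 1 - r \<longrightarrow> cmod (1 - k x y) < \<epsilon>) \<and>
          (\<forall>x\<in>X. \<forall>y\<in>X. M x y T < 1 - R \<longrightarrow> k x y = 0) \<and>
          (\<forall>f\<in>lp_space 2 X. \<forall>x\<in>X. (\<lambda>y. k x y * f y) summable_on X) \<and>
          l2_bounded_operator X (kernel_operator X k) \<and>
          kernel_operator X k \<in> uniform_roe_algebra X M"
    using R by (intro bexI[of _ R] exI[of _ U] conjI exI[of _ ?k]) simp_all
qed

end

text \<open>Condition (iv) appears in two clauses because types cannot be quantified: functions from
  the ambient type to the complex numbers suffice as vectors for the equivalence, and Hilbert spaces
  over any type 'h imply property A.\<close>

theorem theorem5p3: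
  fixes X :: "'a set" and M :: "'a \<Rightarrow> 'a \<Rightarrow> real \<Rightarrow> real" and T :: "real \<Rightarrow> real \<Rightarrow> real"
  assumes "fuzzy_metric_space X M T"
    and "no_zero_divisors T"
    and "uniformly_locally_finite X M"
  shows "(property_A X M \<longleftrightarrow> lp_condition 1 X M) \<and>
         (property_A X M \<longleftrightarrow> lp_condition 2 X M) \<and>
         (property_A X M \<longleftrightarrow> hilbert_condition TYPE('a \<Rightarrow> complex) X M) \<and>
         (hilbert_condition TYPE('h) X M \<longrightarrow> property_A X M) \<and>
         (property_A X M \<longleftrightarrow> real_kernel_condition X M) \<and>
         (property_A X M \<longleftrightarrow> roe_kernel_condition X M)"
proof -
  interpret ulf_fuzzy_metric_space X M T
    using assms by (simp add: ulf_fuzzy_metric_space_def ulf_fuzzy_metric_space_axioms_def)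
  have 1: "property_A X M \<longleftrightarrow> lp_condition 1 X M"
    using property_A_imp_finite_lp_1 finite_lp_1_imp_property_A lp_condition_iff_finite[of 1] by auto
  have 2: "property_A X M \<longleftrightarrow> lp_condition 2 X M"
    using 1 finite_lp_condition_1_imp_2 finite_lp_condition_2_imp_1
      lp_condition_iff_finite[of 1] lp_condition_iff_finite[of 2] by auto
  \<comment> \<open>The square root argument closes the cycle from property A through \<ell>^2,
    Hilbert spaces and real kernels.\<close>
  have conv: "property_A X M" if "real_kernel_condition X M"
    using 2 real_kernel_imp_finite_lp_2[OF that] lp_condition_iff_finite[of 2] by simp
  have 3: "real_kernel_condition X M" if "property_A X M"
    using hilbert_imp_real_kernel[OF lp_2_imp_hilbert] 2 that by simp
  show ?thesis
    using 1 2 3 conv lp_2_imp_hilbert hilbert_imp_real_kernel[where 'h = "'a \<Rightarrow> complex" and X = X and M = M]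
      hilbert_imp_real_kernel[where 'h = 'h and X = X and M = M]
      real_kernel_imp_roe roe_imp_real_kernel[of X M] by blast
qed

end
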